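(* There are ultra-coarsely arithmetically equivalent number fields with a non-empty exceptional set. That is, there exist number fields $K_1$ and $K_2$ such that $\operatorname{lcm}(S_{K_1}(p))=\operatorname{lcm}(S_{K_2}(p))$ for all but finitely many rational primes $p$, but $\operatorname{lcm}(S_{K_1}(p))\neq\operatorname{lcm}(S_{K_2}(p))$ for at least one rational prime $p$.
   Context: For a number field $F$ and a rational prime $p$ with $p\mathcal{O}_F=\mathfrak{p}_1^{e_1}\cdots\mathfrak{p}_n^{e_n}$ (distinct primes $\mathfrak p_i$), the splitting type $S_F(p)$ is the multiset $\{f_i\}_{i=1}^n$ of residual degrees $f_i=[\mathcal{O}_F/\mathfrak{p}_i:\mathbb{Z}/p\mathbb{Z}]$ (ramification indices are not recorded). $\operatorname{lcm}(S_F(p))$ is the least common multiple of the elements of $S_F(p)$. Number fields $K_1,K_2$ are ultra-coarsely arithmetically equivalent if $\operatorname{lcm}(S_{K_1}(p))=\operatorname{lcm}(S_{K_2}(p))$ for all but finitely many $p$; the exceptional set is the set of rational primes $p$ where this equality fails. *)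

theory Defs
  imports
    "HOL-Algebra.Algebraic_Closure_Type"
    "HOL-Algebra.Embedded_Algebras"
    "HOL-Algebra.Ideal_Product"
    "HOL-Algebra.QuotRing"
    "HOL-Library.Multiset"
begin

text \<open>Number fields are taken inside the complex numbers, where every abstract number field
  embeds.\<close>

abbreviation complex_ring :: "complex ring"
  where "complex_ring \<equiv> ring_of_type_algebra"

definition number_field :: "complex set \<Rightarrow> bool"
  where "number_field K \<longleftrightarrow>
    subfield K complex_ring \<and> ring.finite_dimension complex_ring \<rat> K"

definition ring_of_integers :: "complex set \<Rightarrow> complex ring"
  where "ring_of_integers K = complex_ring \<lparr>carrier := {x \<in> K. algebraic_int x}\<rparr>"

definition prime_ideal_factorization ::
    "('a, 'b) ring_scheme \<Rightarrow> 'a set \<Rightarrow> 'a set set \<Rightarrow> ('a set \<Rightarrow> nat) \<Rightarrow> bool"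
  where "prime_ideal_factorization R I A e \<longleftrightarrow>
    finite A \<and> (\<forall>P\<in>A. primeideal P R \<and> 0 < e P) \<and>
    I = (\<Otimes>\<^bsub>ideals_set R\<^esub> P\<in>A. P [^]\<^bsub>ideals_set R\<^esub> e P)"

text \<open>The factorization of the ideal generated by \<open>p\<close> is unique in a ring of integers, so the union
  over all factorizations is the set of primes occurring in that one.\<close>

definition primes_above :: "complex set \<Rightarrow> nat \<Rightarrow> complex set set"
  where "primes_above K p = \<Union>{A. \<exists>e. prime_ideal_factorization (ring_of_integers K)
    (PIdl\<^bsub>ring_of_integers K\<^esub> (of_nat p)) A e}"

text \<open>The prime field \<open>\<int>/p\<int>\<close> of the residue field at \<open>P\<close> is the set of cosets of integers.\<close>

definition residual_degree :: "complex set \<Rightarrow> complex set \<Rightarrow> nat"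
  where "residual_degree K P =
    (let R = ring_of_integers K; k = R Quot P
     in ring.dim k ((\<lambda>x. P +>\<^bsub>R\<^esub> x) ` \<int>) (carrier k))"

definition splitting_type :: "complex set \<Rightarrow> nat \<Rightarrow> nat multiset"
  where "splitting_type K p = image_mset (residual_degree K) (mset_set (primes_above K p))"

definition lcm_mset :: "nat multiset \<Rightarrow> nat"
  where "lcm_mset M = Lcm (set_mset M)"

definition exceptional_set :: "complex set \<Rightarrow> complex set \<Rightarrow> nat set"
  where "exceptional_set K1 K2 =
    {p. prime p \<and> lcm_mset (splitting_type K1 p) \<noteq> lcm_mset (splitting_type K2 p)}"

definition ultra_coarsely_arithmetically_equivalent :: "complex set \<Rightarrow> complex set \<Rightarrow> bool"
  where "ultra_coarsely_arithmetically_equivalent K1 K2 \<longleftrightarrow> finite (exceptional_set K1 K2)"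

end

theory Submission
  imports Defs "Jordan_Normal_Form.Char_Poly" "HOL-Number_Theory.Residues"
begin

text \<open>For a prime that is unramified in \<open>K\<close>, the lcm of the residual degrees is the order of a Frobenius
element acting on the embeddings of \<open>K\<close>, and that action is faithful for the Galois group of the
normal closure of \<open>K\<close>. So a number field and its normal closure have the same lcm at every
unramified prime. At a ramified prime the inertia group intervenes, and the two values may differ.
The witnesses are \<open>K = \<rat>(\<alpha>)\<close> with \<open>\<alpha>\<^sup>3 = 2\<close> and its normal closure \<open>L = \<rat>(\<alpha>, \<omega>)\<close>, where \<open>\<omega>\<close> is a
primitive cube root of unity. The prime 2 is totally ramified in \<open>K\<close>, so its only residual degree
there is 1, whereas it is inert in \<open>\<rat>(\<omega>) \<subseteq> L\<close>, which makes the residual degree in \<open>L\<close> equal to 2.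

Galois theory and the theory of Dedekind domains are avoided by describing the lcm through powers.
A residue field of order \<open>p\<^sup>f\<close> satisfies \<open>f dvd n\<close> iff \<open>x ^ p ^ n = x\<close> for all its elements, so
the lcm of the residual degrees divides \<open>n\<close> iff \<open>x ^ p ^ n - x\<close> lies in every prime above \<open>p\<close>, for
all integers \<open>x\<close> of the field (\<open>lcm_splitting_type_dvd_iff\<close>). If some single \<open>q \<ge> 2\<close> satisfies
\<open>x ^ q \<equiv> x\<close> modulo \<open>p\<close> for all integers \<open>x\<close> of the field, then the ideal generated by \<open>p\<close> is the
product of the primes that contain it, and the condition becomes \<open>x ^ p ^ n \<equiv> x\<close> modulo \<open>p\<close>
(\<open>lcm_splitting_type_dvd_iff_frobenius\<close>).

For \<open>p\<close> other than 2 and 3 such a \<open>q\<close> is \<open>p ^ 6\<close>. Moreover \<open>\<alpha> ^ p ^ n \<equiv> \<alpha>\<close> implies the same for the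
conjugate \<open>\<omega>\<alpha>\<close>, hence for \<open>\<omega>\<close>, hence for all sums and products formed from \<open>\<alpha>\<close> and \<open>\<omega>\<close>. Since 9 times
an integer of \<open>L\<close> is such a sum (\<open>nine_times_closure_integer\<close>), it follows for all integers of \<open>L\<close>.
So the condition for \<open>K\<close> and the condition for \<open>L\<close> are both equivalent to \<open>\<alpha> ^ p ^ n \<equiv> \<alpha>\<close>, and the two
lcms agree (\<open>lcm_splitting_type_eq\<close>).

For \<open>p = 2\<close>, every integer of \<open>L\<close> is congruent to 0, 1, \<open>\<omega>\<close> or \<open>1 + \<omega>\<close> modulo \<open>\<alpha>\<close>. Complex conjugation
excludes the last two for integers of \<open>K\<close>, so \<open>x\<^sup>2 - x\<close> is in every prime of \<open>K\<close> above 2. In \<open>L\<close> the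
ideal of \<open>\<alpha>\<close> is prime with cube the ideal of 2, and it does not contain \<open>\<omega>\<^sup>2 - \<omega>\<close>.\<close>

section \<open>The ring of algebraic integers\<close>

text \<open>The additive group of the complex numbers as a module over the integers, so that the library's spans
are the finitely generated subgroups needed for integrality.\<close>

interpretation int_module: Modules.module "\<lambda>(n::int) (z::complex). of_int n * z"
  by unfold_locales (auto simp: algebra_simps)

text \<open>Multiplication by \<open>x\<close> on the subgroup spanned by \<open>B\<close> is given by an integer matrix, of which \<open>x\<close> is
an eigenvalue with the nonzero eigenvector \<open>B\<close>. So \<open>x\<close> is a root of the characteristic polynomial,
which is monic with integer coefficients.\<close>

lemma algebraic_int_if_stabilises_span:
  fixes x :: complex
  assumes B: "finite B" "1 \<in> B"
    and stab: "\<And>b. b \<in> B \<Longrightarrow> x * b \<in> int_module.span B"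
  shows "algebraic_int x"
proof -
  obtain bs where bs: "set bs = B" "distinct bs"
    using finite_distinct_list[OF B(1)] by blast
  define n where "n = length bs"
  have "\<exists>f. x * b = (\<Sum>b'\<in>B. of_int (f b') * b')" if "b \<in> B" for b
    using stab[OF that] unfolding int_module.span_finite[OF B(1)] by auto
  then obtain F where F: "\<And>b. b \<in> B \<Longrightarrow> x * b = (\<Sum>b'\<in>B. of_int (F b b') * b')"
    by metis
  define A :: "int mat" where "A = mat n n (\<lambda>(i, j). F (bs ! i) (bs ! j))"
  define A' :: "complex mat" where "A' = map_mat of_int A"
  define v where "v = vec_of_list bs"
  have A: "A \<in> carrier_mat n n" by (simp add: A_def)
  have A': "A' \<in> carrier_mat n n" by (simp add: A'_def A_def)
  have v: "v \<in> carrier_vec n" unfolding v_def n_def by (rule carrier_vecI) simp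
  have "A' *\<^sub>v v = x \<cdot>\<^sub>v v"
  proof (rule eq_vecI)
    fix i assume "i < dim_vec (x \<cdot>\<^sub>v v)"
    hence i: "i < n" using v by auto
    hence "(A' *\<^sub>v v) $ i = (\<Sum>j<n. of_int (F (bs ! i) (bs ! j)) * bs ! j)"
      using v by (auto simp: A'_def A_def scalar_prod_def v_def n_def vec_of_list_index
          intro!: sum.cong)
    also have "\<dots> = (\<Sum>b'\<in>B. of_int (F (bs ! i) b') * b')"
      using bs by (intro sum.reindex_bij_betw[of "(!) bs"])
        (auto simp: n_def bij_betw_def inj_on_nth set_conv_nth)
    also have "\<dots> = x * bs ! i"
      using F[of "bs ! i"] bs i by (auto simp: n_def)
    finally show "(A' *\<^sub>v v) $ i = (x \<cdot>\<^sub>v v) $ i"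
      using i by (simp add: v_def n_def vec_of_list_index)
  qed (use A' v in auto)
  moreover have "v \<noteq> 0\<^sub>v n"
  proof
    assume "v = 0\<^sub>v n"
    moreover obtain i where "i < n" "bs ! i = 1"
      using B bs by (metis in_set_conv_nth n_def)
    ultimately show False
      by (metis index_zero_vec(1) v_def vec_of_list_index zero_neq_one)
  qed
  ultimately have "eigenvalue A' x"
    unfolding eigenvalue_def eigenvector_def using A' v by auto
  hence "poly (char_poly A') x = 0"
    using eigenvalue_root_char_poly[OF A'] by simp
  moreover have "char_poly A' = map_poly of_int (char_poly A)"
    unfolding A'_def by (rule of_int_hom.char_poly_hom[OF A])
  moreover have "lead_coeff (char_poly A) = 1"
    using degree_monic_char_poly[OF A] by auto
  ultimately show ?thesis
    by (auto simp: algebraic_int_altdef_ipoly)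
qed

text \<open>A monic integer equation of degree \<open>m\<close> for \<open>x\<close>, solved for \<open>x ^ m\<close>. The factor \<open>c\<close> will be a power of a
second algebraic integer.\<close>

lemma monic_root_power_in_lower_span:
  fixes x :: complex
  assumes "algebraic_int x"
  obtains m where "m > 0" and
    "\<And>c. x ^ m * c \<in> int_module.span ((\<lambda>i. x ^ i * c) ` {..<m})"
proof -
  obtain p where p: "poly (map_poly of_int p) x = 0" "lead_coeff p = 1"
    using assms by (auto simp: algebraic_int_altdef_ipoly)
  define m where "m = degree p"
  have deg: "degree (map_poly of_int p :: complex poly) = m"
    by (simp add: m_def)
  have "0 = (\<Sum>i\<le>m. of_int (coeff p i) * x ^ i)"
    using p(1) unfolding poly_altdef deg by simp
  also have "\<dots> = (\<Sum>i<m. of_int (coeff p i) * x ^ i) + x ^ m"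
    using p(2) by (simp add: m_def flip: lessThan_Suc_atMost)
  finally have pow: "x ^ m = (\<Sum>i<m. of_int (- coeff p i) * x ^ i)"
    by (simp add: sum_negf eq_neg_iff_add_eq_0 add.commute)
  have "m > 0"
  proof (rule ccontr)
    assume "\<not> m > 0"
    thus False using pow by simp
  qed
  moreover have "x ^ m * c \<in> int_module.span ((\<lambda>i. x ^ i * c) ` {..<m})" for c
  proof -
    have "x ^ m * c = (\<Sum>i<m. of_int (- coeff p i) * (x ^ i * c))"
      unfolding pow by (simp add: sum_distrib_right mult.assoc)
    also have "\<dots> \<in> int_module.span ((\<lambda>i. x ^ i * c) ` {..<m})"
      by (intro int_module.span_sum int_module.span_scale int_module.span_base) auto
    finally show ?thesis .
  qed
  ultimately show ?thesis using that by blast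
qed

text \<open>The finitely many products \<open>x ^ i * y ^ j\<close> below the degrees of two monic equations span a subgroup
that is stable under \<open>x\<close> and under \<open>y\<close>, hence under their sum and their product.\<close>

lemma algebraic_int_plus_times:
  fixes x y :: complex
  assumes x: "algebraic_int x" and y: "algebraic_int y"
  shows "algebraic_int (x + y)" "algebraic_int (x * y)"
proof -
  obtain m where m: "m > 0" 
    "\<And>c. x ^ m * c \<in> int_module.span ((\<lambda>i. x ^ i * c) ` {..<m})"
    using monic_root_power_in_lower_span[OF x] by blast
  obtain n where n: "n > 0"
    "\<And>c. y ^ n * c \<in> int_module.span ((\<lambda>i. y ^ i * c) ` {..<n})"
    using monic_root_power_in_lower_span[OF y] by blast
  define B where "B = (\<lambda>(i, j). x ^ i * y ^ j) ` ({..<m} \<times> {..<n})"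
  have B: "finite B" "1 \<in> B"
  proof -
    have "1 = x ^ 0 * y ^ 0" by simp
    thus "1 \<in> B" unfolding B_def using m(1) n(1) by (intro image_eqI[of _ _ "(0, 0)"]) auto
  qed (simp add: B_def)
  have xB: "x * b \<in> int_module.span B" if b: "b \<in> B" for b
  proof -
    obtain i j where ij: "i < m" "j < n" "b = x ^ i * y ^ j"
      using b by (auto simp: B_def)
    show ?thesis
    proof (cases "Suc i < m")
      case True
      hence "x * b \<in> B"
        using ij unfolding B_def by (intro image_eqI[of _ _ "(Suc i, j)"]) auto
      thus ?thesis by (rule int_module.span_base)
    next
      case False
      hence "x * b = x ^ m * y ^ j"
        using ij by (metis Suc_lessI mult.assoc power_Suc)
      also have "\<dots> \<in> int_module.span ((\<lambda>i. x ^ i * y ^ j) ` {..<m})"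
        by (rule m(2))
      also have "\<dots> \<subseteq> int_module.span B"
        using ij by (intro int_module.span_mono) (auto simp: B_def)
      finally show ?thesis .
    qed
  qed
  have yB: "y * b \<in> int_module.span B" if b: "b \<in> B" for b
  proof -
    obtain i j where ij: "i < m" "j < n" "b = x ^ i * y ^ j"
      using b by (auto simp: B_def)
    show ?thesis
    proof (cases "Suc j < n")
      case True
      hence "y * b \<in> B"
        using ij unfolding B_def by (intro image_eqI[of _ _ "(i, Suc j)"]) auto
      thus ?thesis by (rule int_module.span_base)
    next
      case False
      hence "n = Suc j" using ij by linarith
      hence "y * b = y ^ n * x ^ i"
        using ij by (simp add: mult_ac)
      also have "\<dots> \<in> int_module.span ((\<lambda>j. y ^ j * x ^ i) ` {..<n})"
        by (rule n(2))
      also have "\<dots> \<subseteq> int_module.span B"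
        using ij by (intro int_module.span_mono) (auto simp: B_def mult_ac)
      finally show ?thesis .
    qed
  qed
  have xspan: "x * z \<in> int_module.span B" if "z \<in> int_module.span B" for z
    using that
  proof (induction rule: int_module.span_induct_alt)
    case (step c b z)
    have "x * (of_int c * b + z) = of_int c * (x * b) + x * z"
      by (simp add: algebra_simps)
    thus ?case
      using step xB by (metis int_module.span_add int_module.span_scale)
  qed (simp add: int_module.span_zero)
  show "algebraic_int (x + y)"
    using xB yB by (intro algebraic_int_if_stabilises_span[OF B])
      (simp add: distrib_right int_module.span_add)
  show "algebraic_int (x * y)"
    using xspan yB by (intro algebraic_int_if_stabilises_span[OF B]) (simp add: mult.assoc)
qed

section \<open>Finite fields\<close>

lemma (in domain) finite_domain_is_field:
  assumes "finite (carrier R)"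
  shows "field R"
proof (rule cring_fieldI2)
  fix a assume a: "a \<in> carrier R" "a \<noteq> \<zero>"
  have "inj_on (\<lambda>x. a \<otimes> x) (carrier R)"
    using a m_lcancel by (auto intro!: inj_onI)
  hence "(\<lambda>x. a \<otimes> x) ` carrier R = carrier R"
    using a assms by (intro endo_inj_surj) auto
  thus "\<exists>b\<in>carrier R. a \<otimes> b = \<one>"
    by (metis imageE one_closed)
qed simp

text \<open>Coordinates with respect to a basis put the space in bijection with the lists of scalars of length
\<open>dim F (carrier R)\<close>.\<close>

lemma (in ring) card_finite_vector_space:
  assumes F: "subfield F R" and fin: "finite (carrier R)"
  shows "card (carrier R) = card F ^ dim F (carrier R)"
proof -
  have finF: "finite F"
    using subfieldE(3)[OF F] fin finite_subset by blast
  obtain xs where xs: "set xs = carrier R"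
    using finite_list[OF fin] by blast
  have "Span F xs = carrier R"
    using Span_base_incl[OF F, of xs] Span_in_carrier[of F xs] subfieldE(3)[OF F] xs by blast
  hence "finite_dimension F (carrier R)"
    using Span_finite_dimension[OF F, of xs] xs by simp
  hence dim: "dimension (dim F (carrier R)) F (carrier R)"
    using finite_dimensionE[OF F] by (simp add: over_def)
  then obtain Us where Us: "set Us \<subseteq> carrier R" "independent F Us"
      "length Us = dim F (carrier R)" "Span F Us = carrier R"
    using exists_base[OF F] by blast
  let ?coords = "{Ks. set Ks \<subseteq> F \<and> length Ks = length Us}"
  have "bij_betw (\<lambda>Ks. combine Ks Us) ?coords (carrier R)"
  proof (rule bij_betwI')
    fix Ks Ls assume KL: "Ks \<in> ?coords" "Ls \<in> ?coords"
    show "(combine Ks Us = combine Ls Us) = (Ks = Ls)"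
      using unique_decomposition[OF F Us(2), of "combine Ks Us"] KL
        Span_mem_iff_length_version[OF F Us(1), of "combine Ks Us"] by auto
  next
    fix Ks assume "Ks \<in> ?coords"
    thus "combine Ks Us \<in> carrier R"
      using Us(1) subfieldE(3)[OF F] by (intro combine_in_carrier) auto
  next
    fix y assume "y \<in> carrier R"
    thus "\<exists>Ks\<in>?coords. y = combine Ks Us"
      using Span_mem_iff_length_version[OF F Us(1), of y] Us(4) by auto
  qed
  hence "card ?coords = card (carrier R)"
    by (rule bij_betw_same_card)
  thus ?thesis
    using card_lists_length_eq[OF finF, of "length Us"] Us(3) by simp
qed

text \<open>Division with remainder in the exponent: modulo \<open>p ^ d - 1\<close> the number \<open>p ^ n - 1\<close> is congruent to
\<open>p ^ r - 1\<close> with \<open>r = n mod d\<close>, which is too small to be divisible unless \<open>r = 0\<close>.\<close>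

lemma dvd_power_minus_one_iff:
  fixes p :: nat
  assumes "p \<ge> 2" "d > 0" "(p ^ d - 1) dvd (p ^ n - 1)"
  shows "d dvd n"
proof -
  define r where "r = n mod d"
  have n: "n = d * (n div d) + r" by (simp add: r_def)
  have "int (p ^ d - 1) dvd int (p ^ n - 1)"
    using assms(3) by (simp only: int_dvd_int_iff)
  hence "(int p ^ d - 1) dvd (int p ^ n - 1)"
    using assms(1) by (simp add: of_nat_diff)
  moreover have "(int p ^ d - 1) dvd ((int p ^ d) ^ (n div d) - 1)"
    by (simp add: power_diff_1_eq)
  moreover have "int p ^ n - 1 = ((int p ^ d) ^ (n div d) - 1) * int p ^ r + (int p ^ r - 1)"
    by (subst (1) n) (simp add: power_add power_mult algebra_simps)
  ultimately have dvd: "(int p ^ d - 1) dvd (int p ^ r - 1)"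
    by (simp add: dvd_add_right_iff)
  have "r < d" using assms(2) by (simp add: r_def)
  hence "int p ^ r < int p ^ d"
    using assms(1) by (intro power_strict_increasing) auto
  moreover have "int p ^ r \<ge> 1" using assms(1) by simp
  ultimately have "\<not> 0 < int p ^ r - 1"
    using zdvd_imp_le[OF dvd] by linarith
  hence "int p ^ r = 1" using \<open>int p ^ r \<ge> 1\<close> by linarith
  hence "r = 0"
    using assms(1) one_less_power[of "int p" r] by (cases "r = 0") auto
  thus ?thesis by (auto simp: r_def)
qed

text \<open>The \<open>p\<close>-power map of a field with \<open>p ^ d\<close> elements has order exactly \<open>d\<close>: a generator of the cyclic
multiplicative group has order \<open>p ^ d - 1\<close>, so it is fixed by the \<open>n\<close>-th iterate iff \<open>p ^ d - 1\<close>
divides \<open>p ^ n - 1\<close>.\<close>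

lemma (in field) finite_field_frobenius_order:
  assumes fin: "finite (carrier R)" and card: "card (carrier R) = p ^ d" and "p \<ge> 2"
  shows "d dvd n \<longleftrightarrow> (\<forall>x\<in>carrier R. x [^] (p ^ n) = x)"
proof
  have "card {\<zero>, \<one>} \<le> card (carrier R)"
    using fin by (intro card_mono) auto
  hence d: "d > 0" using card by (cases d) auto
  have pos: "p ^ k > 0" for k :: nat using \<open>p \<ge> 2\<close> by simp
  interpret G: group "Multiplicative_Group.mult_of R"
    rewrites "([^]\<^bsub>Multiplicative_Group.mult_of R\<^esub>) = (([^]) :: _ \<Rightarrow> nat \<Rightarrow> _)" and "\<one>\<^bsub>Multiplicative_Group.mult_of R\<^esub> = \<one>"
    by (rule field_mult_group) (simp_all add: fun_eq_iff nat_pow_def mult_of_simps)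
  have order: "Coset.order (Multiplicative_Group.mult_of R) = p ^ d - 1"
    using order_mult_of[OF fin] card by (simp add: Coset.order_def)
  {
    assume "d dvd n"
    then obtain k where n: "n = d * k" by auto
    have step: "x [^] (p ^ d) = x" if x: "x \<in> carrier R" for x
    proof (cases "x = \<zero>")
      case True
      thus ?thesis using pos[of d] by (simp add: nat_pow_zero)
    next
      case False
      hence "x [^] (p ^ d - 1) = \<one>"
        using G.pow_order_eq_1[of x] x order by (simp add: mult_of_simps)
      hence "x [^] Suc (p ^ d - 1) = x" using x by simp
      moreover have "Suc (p ^ d - 1) = p ^ d" using pos[of d] by linarith
      ultimately show ?thesis by (simp only:)
    qed
    have "x [^] (p ^ (d * k)) = x" if x: "x \<in> carrier R" for x
    proof (induction k)
      case (Suc k)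
      have "p ^ (d * Suc k) = p ^ (d * k) * p ^ d"
        by (metis mult_Suc_right power_add mult.commute)
      hence "x [^] (p ^ (d * Suc k)) = (x [^] (p ^ (d * k))) [^] (p ^ d)"
        using x by (simp only: nat_pow_pow)
      thus ?case using Suc step[OF x] by (simp only:)
    qed (use x in simp)
    thus "\<forall>x\<in>carrier R. x [^] (p ^ n) = x" by (simp add: n)
  }
  {
    assume all: "\<forall>x\<in>carrier R. x [^] (p ^ n) = x"
    obtain g where g: "g \<in> carrier (Multiplicative_Group.mult_of R)"
        "carrier (Multiplicative_Group.mult_of R) = {g [^] i | i::nat. i \<in> UNIV}"
      using finite_field_mult_group_has_gen[OF fin] by blast
    have g': "g \<in> carrier R" "g \<noteq> \<zero>" using g(1) by (auto simp: mult_of_simps)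
    have "g \<otimes> g [^] (p ^ n - 1) = g [^] Suc (p ^ n - 1)"
      using g' by (metis nat_pow_Suc2)
    also have "\<dots> = g \<otimes> \<one>"
    proof -
      have "Suc (p ^ n - 1) = p ^ n" using pos[of n] by linarith
      thus ?thesis using bspec[OF all g'(1)] g'(1) by (metis r_one)
    qed
    finally have "g [^] (p ^ n - 1) = \<one>"
      using m_lcancel[of g "g [^] (p ^ n - 1)" \<one>] g' by simp
    hence "G.ord g dvd p ^ n - 1"
      using G.pow_eq_id[of g "p ^ n - 1"] g(1) by simp
    moreover have "G.ord g = p ^ d - 1"
    proof -
      have "generate (Multiplicative_Group.mult_of R) {g} = carrier (Multiplicative_Group.mult_of R)"
        unfolding G.generate_pow_on_finite_carrier[OF finite_mult_of[OF fin] g(1)] g(2) by blast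
      thus ?thesis
        using G.generate_pow_card[OF g(1)] order by (simp add: Coset.order_def)
    qed
    ultimately show "d dvd n"
      using dvd_power_minus_one_iff[of p d n] \<open>p \<ge> 2\<close> d by simp
  }
qed

section \<open>Residue fields of rings of integers\<close>

lemma complex_ring_simps [simp]:
  "carrier complex_ring = UNIV"
  "monoid.mult complex_ring x y = x * y" "ring.add complex_ring x y = x + y"
  "monoid.one complex_ring = 1" "ring.zero complex_ring = 0"
  by (simp_all add: ring_of_type_algebra_def)

lemma complex_ring_a_inv [simp]: "a_inv complex_ring x = - x"
proof -
  interpret field complex_ring by rule
  show ?thesis using minus_equality[of "- x" x] by simp
qed

lemma complex_ring_m_inv [simp]: "x \<noteq> 0 \<Longrightarrow> m_inv complex_ring x = inverse x"
proof -
  interpret field complex_ring by rule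
  show "x \<noteq> 0 \<Longrightarrow> ?thesis" using comm_inv_char[of x "inverse x"] by simp
qed

lemma subfield_complex_ringI:
  assumes "1 \<in> K" "\<And>x y. x \<in> K \<Longrightarrow> y \<in> K \<Longrightarrow> x + y \<in> K"
    "\<And>x. x \<in> K \<Longrightarrow> - x \<in> K" "\<And>x y. x \<in> K \<Longrightarrow> y \<in> K \<Longrightarrow> x * y \<in> K"
    "\<And>x. x \<in> K \<Longrightarrow> x \<noteq> 0 \<Longrightarrow> inverse x \<in> K"
  shows "subfield K complex_ring"
proof -
  interpret field complex_ring by rule
  have "subring K complex_ring"
    by (rule subringI) (use assms in auto)
  thus ?thesis
    by (rule subfieldI') (use assms in auto)
qed

lemma algebraic_int_diff: "algebraic_int x \<Longrightarrow> algebraic_int y \<Longrightarrow> algebraic_int (x - y)" for x y :: complex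
  using algebraic_int_plus_times(1)[of x "- y"] by simp

lemma algebraic_int_power: "algebraic_int x \<Longrightarrow> algebraic_int (x ^ n)" for x :: complex
  by (induction n) (auto intro: algebraic_int_plus_times)

lemma algebraic_int_of_int [simp]: "algebraic_int (of_int n :: complex)"
  and algebraic_int_of_nat [simp]: "algebraic_int (of_nat m :: complex)"
  by (auto intro!: int_imp_algebraic_int)

lemmas algebraic_int_intros = algebraic_int_plus_times algebraic_int_diff algebraic_int_power

text \<open>The ring of integers is studied for an arbitrary subfield of the complex numbers. What finite degree
would give is stated separately for each prime \<open>p\<close>, as the finiteness of the residues modulo \<open>p\<close>.\<close>

locale complex_subfield =
  fixes K :: "complex set"
  assumes subfield: "subfield K complex_ring"
begin

lemma one_mem [simp]: "1 \<in> K"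
  and zero_mem [simp]: "0 \<in> K"
  and add_mem [intro]: "x \<in> K \<Longrightarrow> y \<in> K \<Longrightarrow> x + y \<in> K"
  and uminus_mem [intro]: "x \<in> K \<Longrightarrow> - x \<in> K"
  and mult_mem [intro]: "x \<in> K \<Longrightarrow> y \<in> K \<Longrightarrow> x * y \<in> K"
  using subringE[OF subfieldE(1)[OF subfield]] by simp_all

lemma diff_mem [intro]: "x \<in> K \<Longrightarrow> y \<in> K \<Longrightarrow> x - y \<in> K"
  using add_mem[of x "- y"] by auto

lemma power_mem [intro]: "x \<in> K \<Longrightarrow> x ^ n \<in> K"
  by (induction n) auto

lemma of_nat_mem [simp]: "of_nat n \<in> K"
  by (induction n) auto

lemma of_int_mem [simp]: "of_int n \<in> K"
  by (cases n rule: int_cases2) auto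

lemma inverse_mem [intro]: "x \<in> K \<Longrightarrow> inverse x \<in> K"
proof (cases "x = 0")
  case False
  assume x: "x \<in> K"
  interpret ring complex_ring by rule
  have "x \<in> Units (complex_ring\<lparr>carrier := K\<rparr>)"
    using subfield.subfield_Units[OF subfield] x False by simp
  then obtain y where "y \<in> K" "x * y = 1" by (auto simp: Units_def)
  thus ?thesis using inverse_unique[of x y] by simp
qed simp

lemma divide_mem [intro]: "x \<in> K \<Longrightarrow> y \<in> K \<Longrightarrow> x / y \<in> K"
  by (auto simp: divide_inverse)

abbreviation R where "R \<equiv> ring_of_integers K"

lemma R_simps [simp]:
  "carrier R = {x \<in> K. algebraic_int x}"
  "monoid.mult R x y = x * y" "ring.add R x y = x + y" "monoid.one R = 1" "ring.zero R = 0"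
  by (simp_all add: ring_of_integers_def)

sublocale R: domain R
proof -
  interpret C: field complex_ring by rule
  have "subring {x \<in> K. algebraic_int x} complex_ring"
    by (rule C.subringI) (auto intro: algebraic_int_plus_times)
  thus "domain R"
    unfolding ring_of_integers_def by (rule C.subring_is_domain)
qed

lemma R_a_inv [simp]: "x \<in> K \<Longrightarrow> algebraic_int x \<Longrightarrow> a_inv R x = - x"
  using R.minus_equality[of "- x" x] by auto

lemma R_a_minus [simp]:
  "x \<in> K \<Longrightarrow> algebraic_int x \<Longrightarrow> y \<in> K \<Longrightarrow> algebraic_int y \<Longrightarrow> a_minus R x y = x - y"
  by (simp add: a_minus_def)

lemma R_pow [simp]: "x [^]\<^bsub>R\<^esub> (n :: nat) = x ^ n"
  by (induction n) auto

lemma ideal_subset: "ideal I R \<Longrightarrow> x \<in> I \<Longrightarrow> x \<in> K \<and> algebraic_int x"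
  using ideal.Icarr[of I R x] by simp

lemma ideal_add: "ideal I R \<Longrightarrow> x \<in> I \<Longrightarrow> y \<in> I \<Longrightarrow> x + y \<in> I"
  using additive_subgroup.a_closed[OF ideal.axioms(1), of I R x y] by simp

lemma ideal_mult: "ideal I R \<Longrightarrow> x \<in> I \<Longrightarrow> y \<in> K \<Longrightarrow> algebraic_int y \<Longrightarrow> y * x \<in> I"
  using ideal.I_l_closed[of I R x y] by simp

lemma ideal_diff: "ideal I R \<Longrightarrow> x \<in> I \<Longrightarrow> y \<in> I \<Longrightarrow> x - y \<in> I"
  using ideal_add[of I x "-1 * y"] ideal_mult[of I y "-1"] uminus_mem[OF one_mem] by simp

lemma ideal_zero: "ideal I R \<Longrightarrow> 0 \<in> I"
  using additive_subgroup.zero_closed[OF ideal.axioms(1), of I R] by simp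

lemma ideal_sum_memE:
  assumes "x \<in> set_add R I J"
  obtains i j where "i \<in> I" "j \<in> J" "x = i + j"
  using assms by (auto simp: set_add_def')

lemma principal_ideal_eq: "PIdl\<^bsub>R\<^esub> a = {r * a | r. r \<in> K \<and> algebraic_int r}"
  by (auto simp: cgenideal_def)

lemma mem_principal_iff:
  assumes "p \<noteq> 0" "x \<in> K"
  shows "x \<in> PIdl\<^bsub>R\<^esub> (of_nat p) \<longleftrightarrow> algebraic_int (x / of_nat p)"
  unfolding principal_ideal_eq using assms
  by (auto intro!: exI[of _ "x / of_nat p"])

lemma ideal_mem_if_divisible:
  assumes "ideal I R" "of_nat p \<in> I" "p \<noteq> 0" "x \<in> K" "algebraic_int (x / of_nat p)"
  shows "x \<in> I"
  using ideal_mult[of I "of_nat p" "x / of_nat p"] divide_mem[of x "of_nat p"] assms by simp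

lemma prime_ideal_one_notin:
  assumes "primeideal P R"
  shows "1 \<notin> P"
  using assms ideal.one_imp_carrier[OF primeideal.axioms(1)[OF assms]] primeideal.I_notcarr[OF assms]
  by auto

lemma prime_ideal_mult:
  assumes "primeideal P R" "x * y \<in> P" "x \<in> K" "algebraic_int x" "y \<in> K" "algebraic_int y"
  shows "x \<in> P \<or> y \<in> P"
  using primeideal.I_prime[OF assms(1), of x y] assms by simp

lemma coset_eq_iff:
  assumes "ideal P R" "x \<in> K" "algebraic_int x" "y \<in> K" "algebraic_int y"
  shows "P +>\<^bsub>R\<^esub> x = P +>\<^bsub>R\<^esub> y \<longleftrightarrow> x - y \<in> P"
  using R.quotient_eq_iff_same_a_r_cos[OF assms(1), of x y] assms by simp

text \<open>The prime field of the residue field at \<open>P\<close> has exactly \<open>p\<close> elements: an integer prime to \<open>p\<close> in \<open>P\<close>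
would put a combination equal to 1 into \<open>P\<close>.\<close>

lemma prime_ideal_int_iff:
  assumes P: "primeideal P R" and p: "prime p" "of_nat p \<in> P"
  shows "of_int m \<in> P \<longleftrightarrow> int p dvd m"
proof
  have idl: "ideal P R" using primeideal.axioms(1)[OF P] .
  show "of_int m \<in> P" if "int p dvd m"
  proof -
    from that obtain k where "m = int p * k" by auto
    thus ?thesis using ideal_mult[OF idl p(2), of "of_int k"] by (simp add: mult.commute)
  qed
  show "int p dvd m" if m: "of_int m \<in> P"
  proof (rule ccontr)
    assume "\<not> int p dvd m"
    hence "coprime (int p) m"
      using p(1) by (simp add: prime_imp_coprime)
    then obtain u v where "u * int p + v * m = 1"
      by (metis bezout_int coprime_imp_gcd_eq_1)
    hence "(of_int u * of_nat p + of_int v * of_int m :: complex) = 1"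
      by (metis of_int_1 of_int_add of_int_mult of_int_of_nat_eq)
    moreover have "of_int u * of_nat p + of_int v * of_int m \<in> P"
      using p(2) m by (intro ideal_add[OF idl] ideal_mult[OF idl]) auto
    ultimately show False using prime_ideal_one_notin[OF P] by simp
  qed
qed

text \<open>The residue field has \<open>p\<close> to the residual degree many elements, so the criterion for finite fields
applies and can be pulled back along the projection from the ring of integers.\<close>

lemma residual_degree_dvd_iff:
  assumes P: "primeideal P R" and fin: "finite (carrier (R Quot P))"
    and p: "prime p" "of_nat p \<in> P"
  shows "residual_degree K P dvd n \<longleftrightarrow> (\<forall>x\<in>carrier R. x ^ (p ^ n) - x \<in> P)"
proof -
  have idl: "ideal P R" using primeideal.axioms(1)[OF P] .
  interpret k: domain "R Quot P" by (rule primeideal.quotient_is_domain[OF P])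
  interpret h: ring_hom_ring R "R Quot P" "\<lambda>x. P +>\<^bsub>R\<^esub> x"
    using ideal.rcos_ring_hom_ring[OF idl] .
  interpret k: field "R Quot P" by (rule k.finite_domain_is_field[OF fin])
  define F where "F = (\<lambda>x. P +>\<^bsub>R\<^esub> x) ` \<int>"
  have int: "(\<int> :: complex set) \<subseteq> carrier R" by (auto elim!: Ints_cases)
  have "subring \<int> R"
    by (rule R.subringI) (use int in \<open>auto elim!: Ints_cases\<close>)
  hence sub: "subring F (R Quot P)"
    unfolding F_def by (rule h.img_is_subring)
  have FK: "F \<subseteq> carrier (R Quot P)"
    using subringE(1)[OF sub] .
  have F: "subfield F (R Quot P)"
  proof -
    interpret F: domain "(R Quot P)\<lparr>carrier := F\<rparr>"
      by (rule k.subring_is_domain[OF sub])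
    have "field ((R Quot P)\<lparr>carrier := F\<rparr>)"
      by (rule F.finite_domain_is_field) (use FK fin finite_subset in auto)
    thus ?thesis using k.subfield_iff(1) FK by blast
  qed
  \<comment> \<open>The scalar field \<open>F\<close> of the residual degree has \<open>p\<close> elements.\<close>
  have "bij_betw (\<lambda>m::nat. P +>\<^bsub>R\<^esub> of_nat m) {..<p} F"
  proof (rule bij_betw_imageI)
    show "inj_on (\<lambda>m::nat. P +>\<^bsub>R\<^esub> of_nat m) {..<p}"
    proof (rule inj_onI)
      fix a b assume ab: "a \<in> {..<p}" "b \<in> {..<p}" "P +>\<^bsub>R\<^esub> of_nat a = P +>\<^bsub>R\<^esub> of_nat b"
      hence "of_int (int a - int b) \<in> P"
        using coset_eq_iff[OF idl, of "of_nat a" "of_nat b"] by simp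
      hence "int a mod int p = int b mod int p"
        using prime_ideal_int_iff[OF P p] by (simp only: mod_eq_dvd_iff)
      thus "a = b"
        using ab by simp
    qed
    have "P +>\<^bsub>R\<^esub> x \<in> (\<lambda>m::nat. P +>\<^bsub>R\<^esub> of_nat m) ` {..<p}" if x: "x \<in> \<int>" for x
    proof -
      obtain m where m: "x = of_int m" using x by (auto elim: Ints_cases)
      define r where "r = nat (m mod int p)"
      have r: "int r = m mod int p" using prime_gt_0_nat[OF p(1)] by (simp add: r_def)
      have "int p dvd m - int r" unfolding r by (simp add: mod_eq_dvd_iff)
      hence "of_int (m - int r) \<in> P" using prime_ideal_int_iff[OF P p] by blast
      hence "P +>\<^bsub>R\<^esub> x = P +>\<^bsub>R\<^esub> of_nat r"
        using coset_eq_iff[OF idl, of x "of_nat r"] by (simp add: m)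
      moreover have "int r < int p" unfolding r using prime_gt_0_nat[OF p(1)] by simp
      ultimately show ?thesis by auto
    qed
    thus "(\<lambda>m::nat. P +>\<^bsub>R\<^esub> of_nat m) ` {..<p} = F"
      unfolding F_def by auto
  qed
  hence "card F = p" using bij_betw_same_card by fastforce
  hence card: "card (carrier (R Quot P)) = p ^ residual_degree K P"
    using k.card_finite_vector_space[OF F fin] by (simp add: residual_degree_def F_def Let_def)
  have carr: "carrier (R Quot P) = (\<lambda>x. P +>\<^bsub>R\<^esub> x) ` carrier R"
    by (auto simp: FactRing_def A_RCOSETS_def' )
  have "residual_degree K P dvd n \<longleftrightarrow>
      (\<forall>c\<in>carrier (R Quot P). c [^]\<^bsub>R Quot P\<^esub> (p ^ n) = c)"
    by (rule k.finite_field_frobenius_order[OF fin card prime_ge_2_nat[OF p(1)]])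
  also have "\<dots> \<longleftrightarrow> (\<forall>x\<in>carrier R. P +>\<^bsub>R\<^esub> (x ^ (p ^ n)) = P +>\<^bsub>R\<^esub> x)"
    unfolding carr using h.hom_nat_pow[of _ "p ^ n"] by simp
  also have "\<dots> \<longleftrightarrow> (\<forall>x\<in>carrier R. x ^ (p ^ n) - x \<in> P)"
    using coset_eq_iff[OF idl] by (auto intro: algebraic_int_power)
  finally show ?thesis .
qed


section \<open>Factorizations of unramified primes\<close>

text \<open>A product of ideals lies in each of its factors; the exponent must be positive for the factor to occur.\<close>

lemma finprod_ideals_subset:
  assumes A: "finite A" "\<And>P. P \<in> A \<Longrightarrow> ideal P R" and P: "P \<in> A" "e P > (0::nat)"
  shows "(\<Otimes>\<^bsub>ideals_set R\<^esub> P\<in>A. P [^]\<^bsub>ideals_set R\<^esub> e P) \<subseteq> P"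
proof -
  interpret I: comm_monoid "ideals_set R" by (rule R.ideals_set_is_comm_monoid)
  have carr: "carrier (ideals_set R) = {I. ideal I R}" by (simp add: ideals_set_def)
  have mult: "I \<otimes>\<^bsub>ideals_set R\<^esub> J = I \<cdot>\<^bsub>R\<^esub> J" for I J by (simp add: ideals_set_def)
  have Q: "Q [^]\<^bsub>ideals_set R\<^esub> n \<in> carrier (ideals_set R)" if "Q \<in> A" for Q and n :: nat
    using A(2)[OF that] by (intro I.nat_pow_closed) (simp add: carr)
  obtain k where k: "e P = Suc k" using P(2) gr0_conv_Suc by blast
  have "P [^]\<^bsub>ideals_set R\<^esub> e P \<subseteq> P"
    using R.ideal_prod_inter[of "P [^]\<^bsub>ideals_set R\<^esub> k" P] Q[OF P(1), of k] A(2)[OF P(1)]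
    by (auto simp: k mult carr)
  moreover have "(\<Otimes>\<^bsub>ideals_set R\<^esub> Q\<in>A. Q [^]\<^bsub>ideals_set R\<^esub> e Q) =
      (P [^]\<^bsub>ideals_set R\<^esub> e P) \<cdot>\<^bsub>R\<^esub> (\<Otimes>\<^bsub>ideals_set R\<^esub> Q\<in>A - {P}. Q [^]\<^bsub>ideals_set R\<^esub> e Q)"
    using I.finprod_insert[of "A - {P}" P "\<lambda>Q. Q [^]\<^bsub>ideals_set R\<^esub> e Q"] A(1) P(1) Q
    by (auto simp: insert_absorb mult)
  moreover have "(\<Otimes>\<^bsub>ideals_set R\<^esub> Q\<in>A - {P}. Q [^]\<^bsub>ideals_set R\<^esub> e Q) \<in> carrier (ideals_set R)"
    using Q by (intro I.finprod_closed) auto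
  ultimately show ?thesis
    using R.ideal_prod_inter[of "P [^]\<^bsub>ideals_set R\<^esub> e P"] Q[OF P(1), of "e P"]
    by (auto simp: carr)
qed

lemma primes_above_subset:
  "primes_above K p \<subseteq> {P. primeideal P R \<and> of_nat p \<in> P}"
proof
  fix P assume "P \<in> primes_above K p"
  then obtain A e where A: "P \<in> A" "prime_ideal_factorization R (PIdl\<^bsub>R\<^esub> (of_nat p)) A e"
    by (auto simp: primes_above_def)
  hence "PIdl\<^bsub>R\<^esub> (of_nat p) \<subseteq> P"
    using finprod_ideals_subset[of A P e] primeideal.axioms(1)
    by (auto simp: prime_ideal_factorization_def)
  moreover have "of_nat p \<in> PIdl\<^bsub>R\<^esub> (of_nat p)"
    using R.cgenideal_self[of "of_nat p"] by simp
  ultimately show "P \<in> {P. primeideal P R \<and> of_nat p \<in> P}"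
    using A by (auto simp: prime_ideal_factorization_def)
qed

text \<open>The representatives may be arbitrary complex numbers. In this form the property passes from a field
to its subfields.\<close>

definition finite_residues :: "nat \<Rightarrow> bool" where
  "finite_residues p \<longleftrightarrow> (\<exists>T. finite T \<and> (\<forall>x\<in>carrier R. \<exists>t\<in>T. algebraic_int ((x - t) / of_nat p)))"

text \<open>Each integer is labelled by a representative, so that equal labels force congruence modulo every
ideal containing \<open>p\<close>.\<close>

lemma finite_residues_labelling:
  assumes "finite_residues p" "p > 0"
  shows "\<exists>g :: complex \<Rightarrow> complex. finite (g ` carrier R) \<and>
    (\<forall>I x y. ideal I R \<longrightarrow> of_nat p \<in> I \<longrightarrow> x \<in> carrier R \<longrightarrow> y \<in> carrier R \<longrightarrow> g x = g y \<longrightarrow> x - y \<in> I)"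
proof -
  obtain T where T: "finite T" "\<forall>x\<in>carrier R. \<exists>t\<in>T. algebraic_int ((x - t) / of_nat p)"
    using assms(1) by (auto simp: finite_residues_def)
  then obtain g where g: "\<And>x. x \<in> carrier R \<Longrightarrow> g x \<in> T"
      "\<And>x. x \<in> carrier R \<Longrightarrow> algebraic_int ((x - g x) / of_nat p)"
    by metis
  have "x - y \<in> I"
    if I: "ideal I R" "of_nat p \<in> I" and xy: "x \<in> carrier R" "y \<in> carrier R" "g x = g y" for I x y
  proof (rule ideal_mem_if_divisible[OF I])
    have "(x - y) / of_nat p = (x - g x) / of_nat p - (y - g y) / of_nat p"
      using xy(3) by (simp add: diff_divide_distrib)
    thus "algebraic_int ((x - y) / of_nat p)"
      using algebraic_int_diff[OF g(2)[OF xy(1)] g(2)[OF xy(2)]] by simp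
  qed (use assms(2) xy in auto)
  moreover have "finite (g ` carrier R)"
    using g(1) T(1) by (meson finite_subset image_subsetI)
  ultimately show ?thesis by blast
qed

text \<open>An ideal containing \<open>p\<close> is a union of residue classes modulo \<open>p\<close>, so it is determined by its set of
labels.\<close>

lemma finite_ideals_above:
  assumes "finite_residues p" "p > 0"
  shows "finite {I. ideal I R \<and> of_nat p \<in> I}"
proof -
  obtain g :: "complex \<Rightarrow> complex" where g: "finite (g ` carrier R)"
    "\<forall>I x y. ideal I R \<longrightarrow> of_nat p \<in> I \<longrightarrow> x \<in> carrier R \<longrightarrow> y \<in> carrier R \<longrightarrow> g x = g y \<longrightarrow> x - y \<in> I"
    using finite_residues_labelling[OF assms] by blast
  let ?S = "{I. ideal I R \<and> of_nat p \<in> I}"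
  have sub: "I \<subseteq> carrier R" if "I \<in> ?S" for I
    using that ideal_subset by auto
  have le: "I \<subseteq> J" if IJ: "I \<in> ?S" "J \<in> ?S" "g ` I = g ` J" for I J
  proof
    fix x assume x: "x \<in> I"
    then obtain y where y: "y \<in> J" "g x = g y" using IJ(3) by (metis imageE imageI)
    hence "x - y \<in> J" using g(2)[rule_format, of J x y] IJ(1,2) x sub by blast
    hence "(x - y) + y \<in> J" using ideal_add[of J "x - y" y] y IJ(2) by blast
    thus "x \<in> J" by simp
  qed
  have "inj_on (\<lambda>I. g ` I) ?S"
    using le by (intro inj_onI equalityI) (metis (no_types, lifting))+
  moreover have "(\<lambda>I. g ` I) ` ?S \<subseteq> Pow (g ` carrier R)"
    using sub by blast
  ultimately show ?thesis
    using g(1) by (meson finite_Pow_iff finite_imageD finite_subset)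
qed

lemma finite_residue_ring:
  assumes "finite_residues p" "p > 0" "ideal I R" "of_nat p \<in> I"
  shows "finite (carrier (R Quot I))"
proof -
  obtain g :: "complex \<Rightarrow> complex" where g: "finite (g ` carrier R)"
    "\<forall>I x y. ideal I R \<longrightarrow> of_nat p \<in> I \<longrightarrow> x \<in> carrier R \<longrightarrow> y \<in> carrier R \<longrightarrow> g x = g y \<longrightarrow> x - y \<in> I"
    using finite_residues_labelling[OF assms(1,2)] by blast
  define h where "h t = I +>\<^bsub>R\<^esub> (SOME x. x \<in> carrier R \<and> g x = t)" for t
  have "I +>\<^bsub>R\<^esub> x = h (g x)" if x: "x \<in> carrier R" for x
  proof -
    have *: "(SOME y. y \<in> carrier R \<and> g y = g x) \<in> carrier R \<and> g (SOME y. y \<in> carrier R \<and> g y = g x) = g x"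
      by (rule someI[of _ x]) (use x in blast)
    show ?thesis unfolding h_def
      using coset_eq_iff[OF assms(3), of x] * x g(2)[rule_format, OF assms(3,4) x] by simp
  qed
  hence "carrier (R Quot I) \<subseteq> h ` g ` carrier R"
    by (auto simp: FactRing_def A_RCOSETS_def')
  thus ?thesis using g(1) finite_subset by blast
qed


text \<open>Under the hypotheses \<open>fin\<close> and \<open>frob\<close> the quotient by \<open>p\<close> is a finite reduced ring, that is, a finite product of
fields. This replaces unramifiedness: it yields the factorization of the ideal of \<open>p\<close> into primes
without any theory of Dedekind domains.\<close>

context
  fixes p q :: nat
  assumes fin: "finite_residues p" and p: "p > 1" and q: "q \<ge> 2"
    and frob: "\<forall>x\<in>carrier R. algebraic_int ((x ^ q - x) / of_nat p)"
begin

lemma frobenius_diff_mem_ideal: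
  assumes "ideal I R" "of_nat p \<in> I" "x \<in> carrier R"
  shows "x ^ q - x \<in> I"
  using assms p bspec[OF frob assms(3)] by (intro ideal_mem_if_divisible[OF assms(1,2)]) auto

text \<open>Among the finitely many ideals containing \<open>p\<close> but not \<open>x\<close>, a maximal one \<open>J\<close> is prime: if \<open>a\<close> and \<open>b\<close>
are outside \<open>J\<close>, then \<open>x\<close> lies in \<open>J + (a)\<close> and in \<open>J + (b)\<close>, so \<open>a * b \<in> J\<close> would give \<open>x\<^sup>2 \<in> J\<close>, and
then \<open>x \<in> J\<close> because \<open>x \<equiv> x ^ q\<close>.\<close>

lemma prime_ideal_avoiding:
  assumes x: "x \<in> carrier R" "\<not> algebraic_int (x / of_nat p)"
  obtains P where "primeideal P R" "of_nat p \<in> P" "x \<notin> P"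
proof -
  let ?S = "{I. ideal I R \<and> of_nat p \<in> I \<and> x \<notin> I}"
  have "finite ?S"
    by (rule rev_finite_subset[OF finite_ideals_above[OF fin]]) (use p in auto)
  moreover have "PIdl\<^bsub>R\<^esub> (of_nat p) \<in> ?S"
    using R.cgenideal_ideal[of "of_nat p"] R.cgenideal_self[of "of_nat p"] x p mem_principal_iff[of p x] by simp
  ultimately obtain J where J: "J \<in> ?S" "\<forall>I\<in>?S. J \<subseteq> I \<longrightarrow> J = I"
    using finite_has_maximal[of ?S] by blast
  hence idl: "ideal J R" and pJ: "of_nat p \<in> J" and xJ: "x \<notin> J" by auto
  have step: "\<exists>j r. j \<in> J \<and> r \<in> carrier R \<and> x = j + r * a"
    if a: "a \<in> carrier R" "a \<notin> J" for a
  proof -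
    have idl': "ideal (PIdl\<^bsub>R\<^esub> a) R" using R.cgenideal_ideal[OF a(1)] .
    let ?I = "J <+>\<^bsub>R\<^esub> PIdl\<^bsub>R\<^esub> a"
    have I: "ideal ?I R" using R.add_ideals[OF idl idl'] .
    have "J \<subseteq> ?I"
    proof
      fix y assume y: "y \<in> J"
      have "y + 0 \<in> ?I" using y ideal_zero[OF idl'] by (force simp: set_add_def')
      thus "y \<in> ?I" by simp
    qed
    moreover have "a \<in> ?I"
    proof -
      have "0 + a \<in> ?I"
        using ideal_zero[OF idl] R.cgenideal_self[OF a(1)] by (force simp: set_add_def')
      thus ?thesis by simp
    qed
    ultimately have "?I \<notin> ?S" using J(2) a(2) by blast
    hence "x \<in> ?I" using I pJ \<open>J \<subseteq> ?I\<close> by blast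
    then obtain j b where "j \<in> J" "b \<in> PIdl\<^bsub>R\<^esub> a" "x = j + b" by (rule ideal_sum_memE)
    thus ?thesis unfolding principal_ideal_eq by auto
  qed
  have "primeideal J R"
  proof (rule primeidealI[OF idl R.is_cring])
    show "carrier R \<noteq> J" using x(1) xJ by blast
    fix a b assume ab: "a \<in> carrier R" "b \<in> carrier R" "a \<otimes>\<^bsub>R\<^esub> b \<in> J"
    show "a \<in> J \<or> b \<in> J"
    proof (rule ccontr)
      assume "\<not> (a \<in> J \<or> b \<in> J)"
      then obtain j r k s where *: "j \<in> J" "r \<in> carrier R" "x = j + r * a"
          "k \<in> J" "s \<in> carrier R" "x = k + s * b"
        using step[OF ab(1)] step[OF ab(2)] by blast
      have "x * x = x * j + r * a * x" by (subst (2) *(3)) (simp add: algebra_simps)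
      also have "\<dots> = x * j + (r * a) * k + (r * s) * (a * b)"
        by (subst (2) *(6)) (simp add: algebra_simps)
      also have "\<dots> \<in> J"
      proof (intro ideal_add[OF idl])
        show "x * j \<in> J" using ideal_mult[OF idl *(1)] x(1) by simp
        show "(r * a) * k \<in> J" using ideal_mult[OF idl *(4), of "r * a"] *(2) ab(1)
          by (auto intro: algebraic_int_intros)
        show "(r * s) * (a * b) \<in> J" using ideal_mult[OF idl, of "a * b" "r * s"] *(2,5) ab(3)
          by (auto intro: algebraic_int_intros)
      qed
      finally have xx: "x * x \<in> J" .
      have "x ^ q = x ^ (q - 2) * (x * x)"
        using q by (metis le_add_diff_inverse2 power2_eq_square power_add)
      also have "\<dots> \<in> J"
        using x(1) by (intro ideal_mult[OF idl xx]) (auto intro!: algebraic_int_power)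
      finally have "x ^ q - (x ^ q - x) \<in> J"
        by (rule ideal_diff[OF idl _ frobenius_diff_mem_ideal[OF idl pJ x(1)]])
      thus False using xJ by simp
    qed
  qed
  thus ?thesis using that pJ xJ by blast
qed

text \<open>If \<open>a\<close> is in one of the primes and not in the other, then the idempotent \<open>a ^ (q - 1)\<close> is in the
first one and congruent to 1 modulo the second one.\<close>

lemma prime_ideals_comaximal:
  assumes P: "primeideal P R" "of_nat p \<in> P" and Q: "primeideal Q R" "of_nat p \<in> Q"
    and neq: "P \<noteq> Q"
  shows "P <+>\<^bsub>R\<^esub> Q = carrier R"
proof -
  have main: "\<exists>i\<in>I. \<exists>j\<in>J. i + j = 1"
    if I: "primeideal I R" and J: "primeideal J R" "of_nat p \<in> J" and a: "a \<in> I" "a \<notin> J" for I J a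
  proof -
    have idl: "ideal I R" "ideal J R" using primeideal.axioms(1) I J(1) by auto
    have aR: "a \<in> K" "algebraic_int a" using ideal_subset[OF idl(1) a(1)] by auto
    have qs: "q = Suc (q - 1)" "q - 1 = Suc (q - 2)" using q by auto
    have "a ^ q = a * a ^ (q - 1)" by (subst qs(1)) simp
    hence "a * (a ^ (q - 1) - 1) \<in> J"
      using frobenius_diff_mem_ideal[OF idl(2) J(2), of a] aR by (simp add: algebra_simps)
    hence "a ^ (q - 1) - 1 \<in> J"
      using prime_ideal_mult[OF J(1) _ aR, of "a ^ (q - 1) - 1"] aR a(2)
        diff_mem[OF power_mem[OF aR(1)] one_mem, of "q - 1"]
        algebraic_int_diff[OF algebraic_int_power[OF aR(2)] algebraic_int_of_nat[of 1], of "q - 1"]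
      by (simp only: of_nat_1) blast
    hence "0 - (a ^ (q - 1) - 1) \<in> J"
      using ideal_diff[OF idl(2)] ideal_zero[OF idl(2)] by blast
    moreover have "a ^ (q - 1) \<in> I"
      unfolding qs(2) power_Suc2 using aR by (intro ideal_mult[OF idl(1) a(1)]) (auto intro: algebraic_int_power)
    ultimately show ?thesis
      by (intro bexI[of _ "a ^ (q - 1)"] bexI[of _ "0 - (a ^ (q - 1) - 1)"]) auto
  qed
  have idl: "ideal P R" "ideal Q R" using primeideal.axioms(1) P Q by auto
  obtain a where "a \<in> P \<and> a \<notin> Q \<or> a \<in> Q \<and> a \<notin> P" using neq by blast
  hence "\<exists>i\<in>P. \<exists>j\<in>Q. i + j = 1"
    using main[of P Q a] main[of Q P a] P Q by (metis add.commute)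
  hence "1 \<in> P <+>\<^bsub>R\<^esub> Q" by (force simp: set_add_def')
  thus ?thesis
    using ideal.one_imp_carrier[OF R.add_ideals[OF idl]] by simp
qed

text \<open>By comaximality the product of the primes containing \<open>p\<close> is their intersection, and by
\<open>prime_ideal_avoiding\<close> that intersection is the ideal generated by \<open>p\<close>. So all these primes occur in a
factorization, each with exponent 1.\<close>

lemma primes_above_eq: "primes_above K p = {P. primeideal P R \<and> of_nat p \<in> P}"
proof (rule antisym[OF primes_above_subset])
  let ?A = "{P. primeideal P R \<and> of_nat p \<in> P}"
  interpret I: comm_monoid "ideals_set R" by (rule R.ideals_set_is_comm_monoid)
  have carr: "carrier (ideals_set R) = {I. ideal I R}" by (simp add: ideals_set_def)
  have idl: "ideal P R" if "P \<in> ?A" for P using that primeideal.axioms(1) by auto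
  have finA: "finite ?A"
    by (rule rev_finite_subset[OF finite_ideals_above[OF fin]]) (use p primeideal.axioms(1) in auto)
  \<comment> \<open>The element 1 must be avoided by some prime, so that the set of primes is not empty.\<close>
  have "\<not> algebraic_int (1 / of_nat p :: complex)"
  proof
    assume "algebraic_int (1 / of_nat p :: complex)"
    hence "1 / of_nat p \<in> (\<int> :: complex set)"
      by (rule rational_algebraic_int_is_int) simp
    then obtain m where "1 / of_nat p = (of_int m :: complex)" by (auto elim: Ints_cases)
    hence "of_int 1 = (of_int (m * int p) :: complex)" using p by (simp add: field_simps)
    hence "1 = m * int p" by (simp only: of_int_eq_iff)
    hence "int p dvd 1" by (metis dvd_triv_right)
    thus False using p by (simp add: zdvd1_eq)
  qed
  then obtain P0 where "P0 \<in> ?A"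
    using prime_ideal_avoiding[of 1] by auto
  hence "card ?A > 0" using finA card_gt_0_iff by blast
  then obtain n where n: "card ?A = Suc n" using gr0_conv_Suc by blast
  obtain f where f: "bij_betw f {0..<Suc n} ?A"
    using ex_bij_betw_nat_finite[OF finA] n by auto
  hence f: "bij_betw f {..n} ?A" by (simp add: atLeast0LessThan lessThan_Suc_atMost)
  hence fA: "f i \<in> ?A" if "i \<le> n" for i using that bij_betwE by blast
  have "(\<Otimes>\<^bsub>ideals_set R\<^esub> P\<in>?A. P [^]\<^bsub>ideals_set R\<^esub> (1::nat)) = (\<Otimes>\<^bsub>ideals_set R\<^esub> P\<in>?A. P)"
    using idl by (intro I.finprod_cong') (auto simp: carr)
  also have "\<dots> = (\<Otimes>\<^bsub>ideals_set R\<^esub> P\<in>f ` {..n}. P)"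
    using f by (simp add: bij_betw_def)
  also have "\<dots> = (\<Otimes>\<^bsub>ideals_set R\<^esub> i\<in>{..n}. f i)"
    using f fA idl by (intro I.finprod_reindex) (auto simp: bij_betw_def carr)
  also have "\<dots> = (\<Inter>i\<in>{..n}. f i)"
  proof (rule R.ideal_prod_eq_Inter)
    show "f \<in> {..n} \<rightarrow> {J. ideal J R}" using fA idl by auto
    fix i j assume ij: "i \<in> {..n}" "j \<in> {..n}" "i \<noteq> j"
    hence "f i \<noteq> f j" using f by (auto simp: bij_betw_def inj_on_def)
    thus "f i <+>\<^bsub>R\<^esub> f j = carrier R"
      using ij fA[of i] fA[of j] by (intro prime_ideals_comaximal) auto
  qed
  also have "\<dots> = \<Inter>?A" using f by (simp add: bij_betw_def)
  also have "\<dots> = PIdl\<^bsub>R\<^esub> (of_nat p)"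
  proof
    show "PIdl\<^bsub>R\<^esub> (of_nat p) \<subseteq> \<Inter>?A"
      using R.cgenideal_minimal idl by blast
    show "\<Inter>?A \<subseteq> PIdl\<^bsub>R\<^esub> (of_nat p)"
    proof
      fix x assume x: "x \<in> \<Inter>?A"
      hence xR: "x \<in> carrier R" using \<open>P0 \<in> ?A\<close> ideal_subset idl[of P0] by auto
      have "algebraic_int (x / of_nat p)"
        using prime_ideal_avoiding[OF xR] x by blast
      thus "x \<in> PIdl\<^bsub>R\<^esub> (of_nat p)" using mem_principal_iff[of p x] p xR by simp
    qed
  qed
  finally have "prime_ideal_factorization R (PIdl\<^bsub>R\<^esub> (of_nat p)) ?A (\<lambda>_. 1)"
    using finA by (simp add: prime_ideal_factorization_def)
  hence "?A \<in> {A. \<exists>e. prime_ideal_factorization R (PIdl\<^bsub>R\<^esub> (of_nat p)) A e}" by (intro CollectI exI)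
  thus "?A \<subseteq> primes_above K p"
    unfolding primes_above_def by (rule Union_upper)
qed

end

text \<open>This holds for ramified primes as well. Finiteness of the set of primes above \<open>p\<close> matters here, since
the multiset of degrees would otherwise be empty by convention.\<close>

lemma lcm_splitting_type_dvd_iff:
  assumes fin: "finite_residues p" and p: "prime p"
  shows "lcm_mset (splitting_type K p) dvd n \<longleftrightarrow>
    (\<forall>P\<in>primes_above K p. \<forall>x\<in>carrier R. x ^ (p ^ n) - x \<in> P)"
proof -
  have p0: "p > 0" using prime_gt_0_nat[OF p] .
  have "finite (primes_above K p)"
    using finite_subset[OF _ finite_ideals_above[OF fin p0]] primes_above_subset[of p] primeideal.axioms(1) by blast
  hence "lcm_mset (splitting_type K p) dvd n \<longleftrightarrow> (\<forall>P\<in>primes_above K p. residual_degree K P dvd n)"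
    by (simp add: lcm_mset_def splitting_type_def Lcm_dvd_iff)
  also have "\<dots> \<longleftrightarrow> (\<forall>P\<in>primes_above K p. \<forall>x\<in>carrier R. x ^ (p ^ n) - x \<in> P)"
  proof (intro ball_cong refl)
    fix P assume "P \<in> primes_above K p"
    hence P: "primeideal P R" "of_nat p \<in> P" using primes_above_subset by auto
    show "residual_degree K P dvd n \<longleftrightarrow> (\<forall>x\<in>carrier R. x ^ (p ^ n) - x \<in> P)"
      using residual_degree_dvd_iff[OF P(1) finite_residue_ring[OF fin p0 _ P(2)] p P(2)]
        primeideal.axioms(1)[OF P(1)] by blast
  qed
  finally show ?thesis .
qed

lemma lcm_splitting_type_dvd_iff_frobenius:
  assumes fin: "finite_residues p" and p: "prime p" and q: "q \<ge> 2"
    and frob: "\<forall>x\<in>carrier R. algebraic_int ((x ^ q - x) / of_nat p)"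
  shows "lcm_mset (splitting_type K p) dvd n \<longleftrightarrow>
    (\<forall>x\<in>carrier R. algebraic_int ((x ^ (p ^ n) - x) / of_nat p))"
proof -
  have p1: "p > 1" using prime_gt_1_nat[OF p] .
  have "(\<forall>P\<in>primes_above K p. x ^ (p ^ n) - x \<in> P) \<longleftrightarrow> algebraic_int ((x ^ (p ^ n) - x) / of_nat p)"
    if x: "x \<in> carrier R" for x
  proof -
    have xR: "x ^ (p ^ n) - x \<in> carrier R" using x by (auto intro!: algebraic_int_intros)
    show ?thesis
      unfolding primes_above_eq[OF fin p1 q frob]
    proof safe
      assume all: "\<forall>P\<in>{P. primeideal P R \<and> of_nat p \<in> P}. x ^ (p ^ n) - x \<in> P"
      show "algebraic_int ((x ^ (p ^ n) - x) / of_nat p)"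
      proof (rule ccontr)
        assume "\<not> ?thesis"
        then obtain P where "primeideal P R" "of_nat p \<in> P" "x ^ (p ^ n) - x \<notin> P"
          by (rule prime_ideal_avoiding[OF fin p1 q frob xR])
        thus False using all by blast
      qed
    next
      fix P assume "primeideal P R" "of_nat p \<in> P" "algebraic_int ((x ^ (p ^ n) - x) / of_nat p)"
      thus "x ^ (p ^ n) - x \<in> P"
        using ideal_mem_if_divisible[OF primeideal.axioms(1), of P p "x ^ (p ^ n) - x"] xR p1 by simp
    qed
  qed
  thus ?thesis unfolding lcm_splitting_type_dvd_iff[OF fin p] by blast
qed

end

section \<open>The pure cubic field and its normal closure\<close>

definition cbrt2 :: complex where "cbrt2 = complex_of_real (root 3 2)"
definition omega :: complex where "omega = Complex (-1/2) (sqrt 3 / 2)"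

lemma cbrt2_cube [simp]: "cbrt2 ^ 3 = 2"
proof -
  have "root 3 2 ^ 3 = (2::real)" by (simp add: real_root_pow_pos2)
  thus ?thesis unfolding cbrt2_def by (metis of_real_numeral of_real_power)
qed

lemma cbrt2_nonzero [simp]: "cbrt2 \<noteq> 0"
  using cbrt2_cube by force

lemma cnj_cbrt2 [simp]: "cnj cbrt2 = cbrt2"
  by (simp add: cbrt2_def)

lemma omega_square: "omega ^ 2 = -1 - omega"
  by (simp add: omega_def power2_eq_square complex_eq_iff)

lemma cnj_omega [simp]: "cnj omega = -1 - omega"
  by (simp add: omega_def complex_eq_iff)

lemma omega_cube [simp]: "omega ^ 3 = 1"
proof -
  have "omega ^ 3 = omega * omega ^ 2" by (simp add: power3_eq_cube power2_eq_square)
  also have "\<dots> = - omega - omega ^ 2"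
    by (subst omega_square) (simp add: algebra_simps power2_eq_square)
  finally show ?thesis by (simp add: omega_square)
qed

lemma algebraic_int_root_of_nat:
  assumes "(x :: complex) ^ n = of_nat m" "n > 0"
  shows "algebraic_int x"
  by (rule algebraic_int_root[of "of_nat m" "monom 1 n"])
    (use assms in \<open>auto simp: poly_monom degree_monom_eq coeff_monom\<close>)

lemma algebraic_int_cbrt2 [simp]: "algebraic_int cbrt2"
  by (rule algebraic_int_root_of_nat[of _ 3 2]) auto

lemma algebraic_int_omega [simp]: "algebraic_int omega"
  by (rule algebraic_int_root_of_nat[of _ 3 1]) auto

lemma algebraic_int_quotient_imp_dvd:
  assumes "algebraic_int (of_int m / of_nat k :: complex)" "k > 0"
  shows "int k dvd m"
proof -
  have "(of_int m / of_nat k :: complex) \<in> \<int>"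
    by (rule rational_algebraic_int_is_int[OF assms(1)]) auto
  then obtain r where "of_int m / of_nat k = (of_int r :: complex)" by (auto elim: Ints_cases)
  hence "(of_int m :: complex) = of_int (r * int k)" using assms(2) by (simp add: field_simps)
  hence "m = r * int k" by (simp only: of_int_eq_iff)
  thus ?thesis by simp
qed

lemma no_rational_cube_root_of_two:
  assumes "r \<in> \<rat>" "(r :: complex) ^ 3 = 2"
  shows False
proof -
  have "algebraic_int r" by (rule algebraic_int_root_of_nat[of _ 3 2]) (use assms in auto)
  hence "r \<in> \<int>" using assms(1) rational_algebraic_int_is_int by blast
  then obtain m where m: "r = of_int m" by (auto elim: Ints_cases)
  hence m3: "m ^ 3 = 2" using assms(2)
    by (metis of_int_eq_iff of_int_numeral of_int_power)
  hence "even (m ^ 3)" by simp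
  hence "even m" by simp
  then obtain k where "m = 2 * k" by blast
  hence "8 * k ^ 3 = 2" using m3 by (simp add: power_mult_distrib)
  thus False by presburger
qed

text \<open>The two equations give \<open>b ^ 3 = a * b * c = 2 * c ^ 3\<close>. They arise both when eliminating \<open>\<alpha>\<^sup>2\<close> from a
linear relation between 1, \<open>\<alpha>\<close> and \<open>\<alpha>\<^sup>2\<close>, and when the norm of an element vanishes.\<close>

lemma rational_pure_cubic_degenerate:
  assumes "a \<in> \<rat>" "b \<in> \<rat>" "c \<in> \<rat>" "b ^ 2 = a * c" "a * b = 2 * c ^ 2"
  shows "b = (0::complex)" "c = 0"
proof -
  have "b ^ 3 = (a * b) * c" using assms(4) by (simp add: power3_eq_cube power2_eq_square)
  hence "b ^ 3 = 2 * c ^ 3" unfolding assms(5) by (simp add: power3_eq_cube power2_eq_square)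
  hence "(b / c) ^ 3 = 2" if "c \<noteq> 0" using that by (simp add: power_divide)
  thus "c = 0" using no_rational_cube_root_of_two[of "b / c"] assms(2,3) by auto
  thus "b = 0" using assms(4) by simp
qed

lemma cbrt2_independent:
  assumes abc: "a \<in> \<rat>" "b \<in> \<rat>" "c \<in> \<rat>" and eq: "a + b * cbrt2 + c * cbrt2 ^ 2 = 0"
  shows "a = 0" "b = 0" "c = 0"
proof -
  have "(b ^ 2 - a * c) * cbrt2 = b * (a + b * cbrt2 + c * cbrt2 ^ 2)
      - c * (cbrt2 * (a + b * cbrt2 + c * cbrt2 ^ 2)) + c ^ 2 * cbrt2 ^ 3 - a * b"
    by (simp add: algebra_simps power2_eq_square power3_eq_cube)
  hence lin: "(b ^ 2 - a * c) * cbrt2 = 2 * c ^ 2 - a * b"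
    unfolding eq by simp
  have "b ^ 2 - a * c = 0"
  proof (rule ccontr)
    assume nz: "b ^ 2 - a * c \<noteq> 0"
    hence "cbrt2 = (2 * c ^ 2 - a * b) / (b ^ 2 - a * c)"
      using lin by (simp add: field_simps)
    also have "\<dots> \<in> \<rat>" using abc by (intro Rats_divide Rats_diff Rats_mult Rats_power) auto
    finally show False using no_rational_cube_root_of_two[of cbrt2] by simp
  qed
  thus "b = 0" "c = 0"
    using rational_pure_cubic_degenerate[OF abc] lin by auto
  thus "a = 0" using eq by simp
qed

definition pure_cubic_field :: "complex set" where
  "pure_cubic_field = {a + b * cbrt2 + c * cbrt2 ^ 2 | a b c. a \<in> \<rat> \<and> b \<in> \<rat> \<and> c \<in> \<rat>}"

definition cubic_closure :: "complex set" where
  "cubic_closure = {u + v * omega | u v. u \<in> pure_cubic_field \<and> v \<in> pure_cubic_field}"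

lemma pure_cubic_product:
  fixes z :: complex
  assumes "z ^ 3 = 2"
  shows "(a + b * z + c * z ^ 2) * (a' + b' * z + c' * z ^ 2) =
    (a * a' + 2 * (b * c' + c * b')) + (a * b' + b * a' + 2 * (c * c')) * z + (a * c' + b * b' + c * a') * z ^ 2"
proof -
  have "(a + b * z + c * z ^ 2) * (a' + b' * z + c' * z ^ 2) =
    (a * a' + z ^ 3 * (b * c' + c * b')) + (a * b' + b * a' + z ^ 3 * (c * c')) * z + (a * c' + b * b' + c * a') * z ^ 2"
    by (simp add: algebra_simps power2_eq_square power3_eq_cube)
  thus ?thesis unfolding assms .
qed

text \<open>The field is real. This is what gives access to the integers of the closure through complex
conjugation, and to the inverses there through \<open>x * cnj x\<close>.\<close>

lemma cnj_pure_cubic: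
  assumes "x \<in> pure_cubic_field"
  shows "cnj x = x"
proof -
  have "cnj a = a" if a: "a \<in> \<rat>" for a
  proof -
    obtain m n where "a = of_int m / of_int n" using a by (elim Rats_cases') 
    thus ?thesis by simp
  qed
  thus ?thesis using assms by (auto simp: pure_cubic_field_def)
qed

text \<open>The inverse comes from the norm form \<open>a\<^sup>3 + 2 b\<^sup>3 + 4 c\<^sup>3 - 6 a b c\<close>, which factors as the element
times an explicit cofactor in the field.\<close>

lemma pure_cubic_subfield: "subfield pure_cubic_field complex_ring"
proof (rule subfield_complex_ringI)
  have intro: "x \<in> pure_cubic_field"
    if "x = a + b * cbrt2 + c * cbrt2 ^ 2" "a \<in> \<rat>" "b \<in> \<rat>" "c \<in> \<rat>" for x a b c
    unfolding pure_cubic_field_def using that by blast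
  show "1 \<in> pure_cubic_field" by (rule intro[of _ 1 0 0]) auto
  fix x assume "x \<in> pure_cubic_field"
  then obtain a b c where x: "x = a + b * cbrt2 + c * cbrt2 ^ 2" "a \<in> \<rat>" "b \<in> \<rat>" "c \<in> \<rat>"
    by (auto simp: pure_cubic_field_def)
  show "- x \<in> pure_cubic_field"
    by (rule intro[of _ "-a" "-b" "-c"]) (use x in auto)
  show "inverse x \<in> pure_cubic_field" if nz: "x \<noteq> 0"
  proof -
    \<comment> \<open>The norm \<open>N\<close> and the product \<open>y\<close> of the two other conjugates.\<close>
    define N where "N = a ^ 3 + 2 * b ^ 3 + 4 * c ^ 3 - 6 * a * b * c"
    define y where "y = (a ^ 2 - 2 * b * c) + (2 * c ^ 2 - a * b) * cbrt2 + (b ^ 2 - a * c) * cbrt2 ^ 2"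
    have xy: "x * y = N"
      unfolding x(1) y_def pure_cubic_product[OF cbrt2_cube] N_def
      by (simp add: algebra_simps power2_eq_square power3_eq_cube)
    have "N \<noteq> 0"
    proof
      assume "N = 0"
      hence "y = 0" using xy nz by simp
      hence "a ^ 2 - 2 * b * c = 0" "2 * c ^ 2 - a * b = 0" "b ^ 2 - a * c = 0"
        using cbrt2_independent[of "a ^ 2 - 2 * b * c" "2 * c ^ 2 - a * b" "b ^ 2 - a * c"] x(2-4)
        unfolding y_def by auto
      moreover from this have "b = 0" "c = 0"
        using rational_pure_cubic_degenerate[OF x(2-4)] by auto
      ultimately have "x = 0" unfolding x(1) by simp
      thus False using nz by simp
    qed
    moreover have "N \<in> \<rat>" unfolding N_def using x(2-4) by auto
    moreover have "inverse x = y / N" using xy nz \<open>N \<noteq> 0\<close> by (simp add: field_simps)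
    ultimately show ?thesis
      using x(2-4)
      by (intro intro[of _ "(a ^ 2 - 2 * b * c) / N" "(2 * c ^ 2 - a * b) / N" "(b ^ 2 - a * c) / N"])
        (auto simp: y_def add_divide_distrib)
  qed
  fix y assume "y \<in> pure_cubic_field"
  then obtain d e f where y: "y = d + e * cbrt2 + f * cbrt2 ^ 2" "d \<in> \<rat>" "e \<in> \<rat>" "f \<in> \<rat>"
    by (auto simp: pure_cubic_field_def)
  show "x + y \<in> pure_cubic_field"
    by (rule intro[of _ "a + d" "b + e" "c + f"]) (use x y in \<open>auto simp: algebra_simps\<close>)
  show "x * y \<in> pure_cubic_field"
    by (rule intro) (unfold x(1) y(1), rule pure_cubic_product[OF cbrt2_cube], use x y in auto)
qed

interpretation cubic: complex_subfield pure_cubic_field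
  by (rule complex_subfield.intro[OF pure_cubic_subfield])

lemma cubic_closure_subfield: "subfield cubic_closure complex_ring"
proof (rule subfield_complex_ringI)
  have intro: "x \<in> cubic_closure"
    if "x = u + v * omega" "u \<in> pure_cubic_field" "v \<in> pure_cubic_field" for x u v
    unfolding cubic_closure_def using that by blast
  show "1 \<in> cubic_closure" by (rule intro[of _ 1 0]) auto
  fix x assume "x \<in> cubic_closure"
  then obtain u v where x: "x = u + v * omega" "u \<in> pure_cubic_field" "v \<in> pure_cubic_field"
    by (auto simp: cubic_closure_def)
  show "- x \<in> cubic_closure"
    by (rule intro[of _ "-u" "-v"]) (use x in auto)
  have prod: "(u + v * omega) * (u' + v' * omega) = (u * u' - v * v') + (u * v' + v * u' - v * v') * omega" for u v u' v'
  proof -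
    have "(u + v * omega) * (u' + v' * omega) = u * u' + v * v' * omega ^ 2 + (u * v' + v * u') * omega"
      by (simp add: algebra_simps power2_eq_square)
    thus ?thesis unfolding omega_square by (simp add: algebra_simps)
  qed
  show "inverse x \<in> cubic_closure" if nz: "x \<noteq> 0"
  proof -
    have cnj: "cnj x = (u - v) + (- v) * omega"
      using x(2,3) by (simp add: x(1) cnj_pure_cubic algebra_simps)
    define N where "N = x * cnj x"
    have "N = u * (u - v) + v * v"
      unfolding N_def cnj unfolding x(1) prod by (simp add: algebra_simps)
    hence "N \<in> pure_cubic_field" using x(2,3) by (auto intro!: cubic.add_mem cubic.mult_mem cubic.diff_mem)
    moreover have "N \<noteq> 0" using nz by (simp add: N_def)
    moreover from this have "inverse x = cnj x / N" using nz by (simp add: N_def field_simps)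
    ultimately show ?thesis
      using x(2,3)
      by (intro intro[of _ "(u - v) / N" "(- v) / N"])
        (auto simp: cnj diff_divide_distrib intro!: cubic.divide_mem cubic.diff_mem)
  qed
  fix y assume "y \<in> cubic_closure"
  then obtain u' v' where y: "y = u' + v' * omega" "u' \<in> pure_cubic_field" "v' \<in> pure_cubic_field"
    by (auto simp: cubic_closure_def)
  show "x + y \<in> cubic_closure"
    by (rule intro[of _ "u + u'" "v + v'"]) (use x y in \<open>auto simp: algebra_simps\<close>)
  show "x * y \<in> cubic_closure"
    by (rule intro) (unfold x(1) y(1), rule prod, use x y in auto)
qed

interpretation closure: complex_subfield cubic_closure
  by (rule complex_subfield.intro[OF cubic_closure_subfield])

lemma pure_cubic_subset_closure: "pure_cubic_field \<subseteq> cubic_closure"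
proof
  fix x assume "x \<in> pure_cubic_field"
  moreover have "x = x + 0 * omega" by simp
  ultimately show "x \<in> cubic_closure"
    unfolding cubic_closure_def using cubic.zero_mem by blast
qed

lemma cbrt2_mem: "cbrt2 \<in> pure_cubic_field"
proof -
  have "cbrt2 = 0 + 1 * cbrt2 + 0 * cbrt2 ^ 2" by simp
  thus ?thesis unfolding pure_cubic_field_def using Rats_0 Rats_1 by blast
qed

lemma omega_mem: "omega \<in> cubic_closure"
proof -
  have "omega = 0 + 1 * omega" by simp
  thus ?thesis unfolding cubic_closure_def using cubic.zero_mem cubic.one_mem by blast
qed

lemma Rats_subfield: "subfield \<rat> complex_ring"
  by (rule subfield_complex_ringI) auto

lemma number_field_if_combinations:
  assumes "subfield K complex_ring"
    and K: "\<And>x. x \<in> K \<longleftrightarrow> (\<exists>cs. length cs = length us \<and> set cs \<subseteq> \<rat> \<and> x = (\<Sum>(c, u)\<leftarrow>zip cs us. c * u))"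
  shows "number_field K"
proof -
  interpret C: field complex_ring by rule
  have comb: "C.combine cs us = (\<Sum>(c, u)\<leftarrow>zip cs us. c * u)" for cs us
    by (induction cs us rule: C.combine.induct) auto
  have "K = C.Span \<rat> us"
    using K C.Span_mem_iff_length_version[OF Rats_subfield, of us] comb
    by (auto simp del: C.Span.simps)
  thus ?thesis unfolding number_field_def
    using assms(1) C.Span_finite_dimension[OF Rats_subfield, of us] by simp
qed

lemma number_field_pure_cubic: "number_field pure_cubic_field"
proof (rule number_field_if_combinations[OF pure_cubic_subfield, where us = "[1, cbrt2, cbrt2 ^ 2]"])
  fix x
  show "x \<in> pure_cubic_field \<longleftrightarrow> (\<exists>cs. length cs = length [1, cbrt2, cbrt2 ^ 2] \<and> set cs \<subseteq> \<rat> \<and>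
      x = (\<Sum>(c, u)\<leftarrow>zip cs [1, cbrt2, cbrt2 ^ 2]. c * u))" (is "_ \<longleftrightarrow> (\<exists>cs. ?P cs)")
  proof
    assume "x \<in> pure_cubic_field"
    then obtain a b c where "x = a + b * cbrt2 + c * cbrt2 ^ 2" "a \<in> \<rat>" "b \<in> \<rat>" "c \<in> \<rat>"
      by (auto simp: pure_cubic_field_def)
    hence "?P [a, b, c]" by simp
    thus "\<exists>cs. ?P cs" ..
  next
    assume "\<exists>cs. ?P cs"
    then obtain cs where cs: "?P cs" ..
    then obtain a b c where "cs = [a, b, c]"
      by (auto simp: length_Suc_conv)
    with cs have "x = a + b * cbrt2 + c * cbrt2 ^ 2" "a \<in> \<rat>" "b \<in> \<rat>" "c \<in> \<rat>" by auto
    thus "x \<in> pure_cubic_field" unfolding pure_cubic_field_def by blast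
  qed
qed

lemma number_field_cubic_closure: "number_field cubic_closure"
proof (rule number_field_if_combinations[OF cubic_closure_subfield,
      where us = "[1, cbrt2, cbrt2 ^ 2, omega, cbrt2 * omega, cbrt2 ^ 2 * omega]"])
  fix x
  show "x \<in> cubic_closure \<longleftrightarrow>
      (\<exists>cs. length cs = length [1, cbrt2, cbrt2 ^ 2, omega, cbrt2 * omega, cbrt2 ^ 2 * omega] \<and> set cs \<subseteq> \<rat> \<and>
      x = (\<Sum>(c, u)\<leftarrow>zip cs [1, cbrt2, cbrt2 ^ 2, omega, cbrt2 * omega, cbrt2 ^ 2 * omega]. c * u))"
    (is "_ \<longleftrightarrow> (\<exists>cs. ?P cs)")
  proof
    assume "x \<in> cubic_closure"
    then obtain u v where uv: "x = u + v * omega" "u \<in> pure_cubic_field" "v \<in> pure_cubic_field"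
      by (auto simp: cubic_closure_def)
    obtain a b c where u: "u = a + b * cbrt2 + c * cbrt2 ^ 2" "a \<in> \<rat>" "b \<in> \<rat>" "c \<in> \<rat>"
      using uv(2) by (auto simp: pure_cubic_field_def)
    obtain d e f where v: "v = d + e * cbrt2 + f * cbrt2 ^ 2" "d \<in> \<rat>" "e \<in> \<rat>" "f \<in> \<rat>"
      using uv(3) by (auto simp: pure_cubic_field_def)
    have "?P [a, b, c, d, e, f]" using u v by (simp add: uv(1) distrib_right mult.assoc)
    thus "\<exists>cs. ?P cs" ..
  next
    assume "\<exists>cs. ?P cs"
    then obtain cs where cs: "?P cs" ..
    then obtain a b c d e f where "cs = [a, b, c, d, e, f]"
      by (auto simp: length_Suc_conv)
    with cs have *: "x = (a + b * cbrt2 + c * cbrt2 ^ 2) + (d + e * cbrt2 + f * cbrt2 ^ 2) * omega"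
      "a \<in> \<rat>" "b \<in> \<rat>" "c \<in> \<rat>" "d \<in> \<rat>" "e \<in> \<rat>" "f \<in> \<rat>"
      by (simp_all add: distrib_right mult.assoc)
    hence "a + b * cbrt2 + c * cbrt2 ^ 2 \<in> pure_cubic_field" "d + e * cbrt2 + f * cbrt2 ^ 2 \<in> pure_cubic_field"
      unfolding pure_cubic_field_def by blast+
    thus "x \<in> cubic_closure" unfolding cubic_closure_def *(1) by blast
  qed
qed

section \<open>Denominators of integers\<close>

text \<open>The coefficients \<open>a'\<close>, \<open>b'\<close>, \<open>c'\<close> do not depend on which cube root \<open>z\<close> of 2 is chosen. This uniformity
stands in for the embeddings of the cubic field.\<close>

lemma int_poly_pure_cubic:
  fixes a b c :: complex
  assumes "a \<in> \<rat>" "b \<in> \<rat>" "c \<in> \<rat>"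
  shows "\<exists>a' b' c'. a' \<in> \<rat> \<and> b' \<in> \<rat> \<and> c' \<in> \<rat> \<and>
    (\<forall>z. z ^ 3 = 2 \<longrightarrow> poly (map_poly of_int p) (a + b * z + c * z ^ 2) = a' + b' * z + c' * z ^ 2)"
proof (induction p)
  case 0
  show ?case by (intro exI[of _ 0]) auto
next
  case (pCons k p)
  then obtain d e f where def: "d \<in> \<rat>" "e \<in> \<rat>" "f \<in> \<rat>"
    "\<And>z. z ^ 3 = 2 \<Longrightarrow> poly (map_poly of_int p) (a + b * z + c * z ^ 2) = d + e * z + f * z ^ 2"
    by blast
  let ?a = "of_int k + (a * d + 2 * (b * f + c * e))" and ?b = "a * e + b * d + 2 * (c * f)"
    and ?c = "a * f + b * e + c * d"
  have "poly (map_poly of_int (pCons k p)) (a + b * z + c * z ^ 2) = ?a + ?b * z + ?c * z ^ 2"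
    if z: "z ^ 3 = 2" for z
    using pCons.hyps
    by (simp add: map_poly_pCons def(4)[OF z] pure_cubic_product[OF z])
  moreover have "?a \<in> \<rat>" "?b \<in> \<rat>" "?c \<in> \<rat>" using assms def(1-3) by auto
  ultimately show ?case by blast
qed

text \<open>A monic integer equation for the element at the real root becomes, by independence of 1, \<open>\<alpha>\<close>, \<open>\<alpha>\<^sup>2\<close>
over the rationals, an identity between coefficients, which holds at every other root as well.\<close>

lemma algebraic_int_conjugate:
  assumes abc: "a \<in> \<rat>" "b \<in> \<rat>" "c \<in> \<rat>"
    and int: "algebraic_int (a + b * cbrt2 + c * cbrt2 ^ 2)" and z: "z ^ 3 = 2"
  shows "algebraic_int (a + b * z + c * z ^ 2)"
proof -
  obtain p where p: "poly (map_poly of_int p) (a + b * cbrt2 + c * cbrt2 ^ 2) = 0" "lead_coeff p = 1"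
    using int by (auto simp: algebraic_int_altdef_ipoly)
  obtain a' b' c' where *: "a' \<in> \<rat>" "b' \<in> \<rat>" "c' \<in> \<rat>"
    "\<And>z. z ^ 3 = 2 \<Longrightarrow> poly (map_poly of_int p) (a + b * z + c * z ^ 2) = a' + b' * z + c' * z ^ 2"
    using int_poly_pure_cubic[OF abc, of p] by blast
  have "a' + b' * cbrt2 + c' * cbrt2 ^ 2 = 0"
    using *(4)[OF cbrt2_cube] p(1) by simp
  hence "a' = 0" "b' = 0" "c' = 0" using cbrt2_independent[OF *(1-3)] by auto
  hence "poly (map_poly of_int p) (a + b * z + c * z ^ 2) = 0" using *(4)[OF z] by simp
  thus ?thesis using p(2) by (auto simp: algebraic_int_altdef_ipoly)
qed

lemma square_cube: "(x ^ 2) ^ 3 = (x ^ 3) ^ 2" for x :: complex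
  by (simp flip: power_mult)

text \<open>The sum of the three conjugates is \<open>3 * a\<close>, because \<open>1 + \<omega> + \<omega>\<^sup>2 = 0\<close>.\<close>

lemma trace_is_integer:
  assumes abc: "a \<in> \<rat>" "b \<in> \<rat>" "c \<in> \<rat>"
    and int: "algebraic_int (a + b * cbrt2 + c * cbrt2 ^ 2)"
  shows "3 * a \<in> \<int>"
proof -
  have z: "(omega * cbrt2) ^ 3 = 2" "(omega ^ 2 * cbrt2) ^ 3 = 2"
    unfolding power_mult_distrib square_cube by simp_all
  have "(a + b * cbrt2 + c * cbrt2 ^ 2) + ((a + b * (omega * cbrt2) + c * (omega * cbrt2) ^ 2)
      + (a + b * (omega ^ 2 * cbrt2) + c * (omega ^ 2 * cbrt2) ^ 2))
    = 3 * a + b * cbrt2 * (1 + omega + omega ^ 2) + c * cbrt2 ^ 2 * (1 + omega ^ 2 + omega * omega ^ 3)"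
    by (simp add: algebra_simps power2_eq_square power3_eq_cube)
  also have "\<dots> = 3 * a" by (simp add: omega_square)
  finally have "algebraic_int (3 * a)"
    using algebraic_int_plus_times(1)[OF int algebraic_int_plus_times(1)[OF
        algebraic_int_conjugate[OF abc int z(1)] algebraic_int_conjugate[OF abc int z(2)]]]
    by simp
  thus ?thesis using abc by (intro rational_algebraic_int_is_int) auto
qed

lemma even_if_half_cube_algebraic_int:
  assumes "algebraic_int (of_int m ^ 3 / 2 :: complex)"
  shows "even m"
  using algebraic_int_quotient_imp_dvd[of "m ^ 3" 2] assms by simp

text \<open>The traces of \<open>y\<close>, \<open>\<alpha> y\<close> and \<open>\<alpha>\<^sup>2 y\<close> bound the denominators by 3, 6 and 6. The remaining factor 2 in
the last two is removed by hand: \<open>\<alpha>\<close> divides \<open>B\<close> and then \<open>C\<close>, and a rational integer divisible by \<open>\<alpha>\<close>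
is even, as one sees from its cube. Having an odd denominator is essential for the prime 2.\<close>

lemma three_times_pure_cubic_integer:
  assumes y: "y \<in> pure_cubic_field" "algebraic_int y"
  shows "\<exists>A B C. 3 * y = of_int A + of_int B * cbrt2 + of_int C * cbrt2 ^ 2"
proof -
  obtain a b c where abc: "y = a + b * cbrt2 + c * cbrt2 ^ 2" "a \<in> \<rat>" "b \<in> \<rat>" "c \<in> \<rat>"
    using y(1) by (auto simp: pure_cubic_field_def)
  have "3 * a \<in> \<int>" using trace_is_integer[OF abc(2-4)] y(2) abc(1) by simp
  moreover have "3 * (2 * c) \<in> \<int>"
  proof -
    have "cbrt2 * y = 2 * c + a * cbrt2 + b * cbrt2 ^ 2"
      unfolding abc(1) using cbrt2_cube by (simp add: algebra_simps power2_eq_square power3_eq_cube)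
    hence "algebraic_int (2 * c + a * cbrt2 + b * cbrt2 ^ 2)"
      using algebraic_int_plus_times(2)[OF algebraic_int_cbrt2 y(2)] by simp
    thus ?thesis using abc(2-4) by (intro trace_is_integer[of _ a b]) auto
  qed
  moreover have "3 * (2 * b) \<in> \<int>"
  proof -
    have "cbrt2 ^ 2 * y = cbrt2 ^ 3 * b + cbrt2 ^ 3 * c * cbrt2 + a * cbrt2 ^ 2"
      unfolding abc(1) by (simp add: algebra_simps power2_eq_square power3_eq_cube)
    hence "algebraic_int (2 * b + (2 * c) * cbrt2 + a * cbrt2 ^ 2)"
      using algebraic_int_plus_times(2)[OF algebraic_int_power[OF algebraic_int_cbrt2] y(2), of 2]
      by (simp add: mult_ac)
    thus ?thesis using abc(2-4) by (intro trace_is_integer[of _ "2 * c" a]) auto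
  qed
  ultimately obtain A B C where ABC: "3 * a = of_int A" "6 * b = of_int B" "6 * c = of_int C"
    by (auto elim!: Ints_cases)
  define Y where "Y = 3 * y - of_int A"
  have Y: "Y = (of_int B * cbrt2 + of_int C * cbrt2 ^ 2) / 2"
    unfolding Y_def abc(1) ABC(1)[symmetric] ABC(2,3)[symmetric] by (simp add: field_simps)
  have intY: "algebraic_int Y"
    unfolding Y_def using y(2) algebraic_int_of_nat[of 3] algebraic_int_plus_times(2)[of 3 y]
    by (auto intro: algebraic_int_diff)
  have "even B"
  proof (rule even_if_half_cube_algebraic_int)
    \<comment> \<open>The quotient of \<open>B\<close> by \<open>\<alpha>\<close>, read off from \<open>\<alpha>\<^sup>2 Y = B + C \<alpha>\<close>.\<close>
    define t where "t = cbrt2 * Y - of_int C"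
    have "cbrt2 * t = cbrt2 ^ 3 / 2 * (of_int B + of_int C * cbrt2) - of_int C * cbrt2"
      unfolding t_def Y by (simp add: field_simps power2_eq_square power3_eq_cube)
    hence "of_int B = cbrt2 * t" by simp
    hence "of_int B ^ 3 / 2 = t ^ 3" by (simp add: power_mult_distrib)
    moreover have "algebraic_int t"
      unfolding t_def by (intro algebraic_int_intros intY) auto
    ultimately show "algebraic_int (of_int B ^ 3 / 2 :: complex)"
      by (simp add: algebraic_int_power)
  qed
  then obtain B' where B': "B = 2 * B'" by blast
  have "even C"
  proof (rule even_if_half_cube_algebraic_int)
    have eq: "Y - of_int B' * cbrt2 = of_int C * cbrt2 ^ 2 / 2"
      unfolding Y B' by (simp add: field_simps)
    have "(cbrt2 ^ 2) ^ 3 = 4" unfolding square_cube by simp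
    hence "of_int C ^ 3 / 2 = (Y - of_int B' * cbrt2) ^ 3"
      unfolding eq by (simp add: power_mult_distrib power_divide)
    thus "algebraic_int (of_int C ^ 3 / 2 :: complex)"
      using intY by (auto intro!: algebraic_int_intros)
  qed
  then obtain C' where C': "C = 2 * C'" by blast
  have "3 * y = of_int A + of_int B' * cbrt2 + of_int C' * cbrt2 ^ 2"
    using Y unfolding Y_def B' C' by (simp add: field_simps)
  thus ?thesis by blast
qed

definition cubic_point :: "int \<Rightarrow> int \<Rightarrow> int \<Rightarrow> complex" where
  "cubic_point a b c = of_int a + of_int b * cbrt2 + of_int c * cbrt2 ^ 2"

lemma algebraic_int_cubic_point: "algebraic_int (cubic_point a b c)"
  unfolding cubic_point_def
  by (intro algebraic_int_plus_times algebraic_int_power algebraic_int_of_int algebraic_int_cbrt2)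

lemma cubic_point_add: "cubic_point (a + a') (b + b') (c + c') = cubic_point a b c + cubic_point a' b' c'"
  by (simp add: cubic_point_def distrib_right)

lemma cubic_point_scale: "cubic_point (k * a) (k * b) (k * c) = of_int k * cubic_point a b c"
  unfolding cubic_point_def of_int_mult distrib_left mult.assoc ..

definition lattice_point :: "int \<Rightarrow> int \<Rightarrow> int \<Rightarrow> int \<Rightarrow> int \<Rightarrow> int \<Rightarrow> complex" where
  "lattice_point a b c d e f = cubic_point a b c + cubic_point d e f * omega"

lemma algebraic_int_lattice_point: "algebraic_int (lattice_point a b c d e f)"
  unfolding lattice_point_def
  by (intro algebraic_int_plus_times algebraic_int_cubic_point algebraic_int_omega)

lemma lattice_point_add: "lattice_point (a + a') (b + b') (c + c') (d + d') (e + e') (f + f') =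
    lattice_point a b c d e f + lattice_point a' b' c' d' e' f'"
  unfolding lattice_point_def cubic_point_add by (simp add: distrib_right)

lemma lattice_point_scale:
  "lattice_point (k * a) (k * b) (k * c) (k * d) (k * e) (k * f) = of_int k * lattice_point a b c d e f"
  unfolding lattice_point_def cubic_point_scale distrib_left mult.assoc ..

text \<open>Conjugation isolates the two coefficients over the cubic field: \<open>cnj w - w\<close> for \<open>w = s + t \<omega>\<close>
multiplied by \<open>1 + 2 \<omega>\<close>, a square root of \<open>-3\<close>, is \<open>3 t\<close>, and multiplying \<open>x\<close> by \<open>\<omega>\<^sup>2\<close> moves the other
coefficient into the place of \<open>t\<close>. Both steps together cost a factor \<open>3 * 3\<close>.\<close>

lemma nine_times_closure_integer:
  assumes x: "x \<in> cubic_closure" "algebraic_int x"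
  shows "\<exists>a b c d e f. 9 * x = lattice_point a b c d e f"
proof -
  obtain u v where uv: "x = u + v * omega" "u \<in> pure_cubic_field" "v \<in> pure_cubic_field"
    using x(1) by (auto simp: cubic_closure_def)
  have coeff: "algebraic_int (3 * t)"
    if st: "algebraic_int (s + t * omega)" "s \<in> pure_cubic_field" "t \<in> pure_cubic_field" for s t
  proof -
    let ?w = "s + t * omega"
    have "(cnj ?w - ?w) * (1 + 2 * omega) = t * (-1 - 4 * omega - 4 * omega ^ 2)"
      using st(2,3) by (simp add: cnj_pure_cubic algebra_simps power2_eq_square)
    also have "\<dots> = 3 * t" unfolding omega_square by simp
    finally have "3 * t = (cnj ?w - ?w) * (1 + of_int 2 * omega)" by simp
    also have "algebraic_int \<dots>"
      by (intro algebraic_int_intros algebraic_int_cnj st(1)) auto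
    finally show ?thesis .
  qed
  have "algebraic_int (3 * v)" using coeff[of u v] uv x by simp
  moreover have "algebraic_int (3 * u)"
  proof -
    have "x * omega ^ 2 = u * omega ^ 2 + v * omega ^ 3"
      unfolding uv(1) by (simp add: algebra_simps power2_eq_square power3_eq_cube)
    hence eq: "x * omega ^ 2 = (v - u) + (- u) * omega"
      by (simp add: omega_square algebra_simps)
    have "algebraic_int (x * omega ^ 2)"
      by (intro algebraic_int_intros x(2)) simp
    hence "algebraic_int ((v - u) + (- u) * omega)" by (simp only: eq)
    moreover have "v - u \<in> pure_cubic_field" "- u \<in> pure_cubic_field"
      using uv(2,3) by (auto intro: cubic.diff_mem)
    ultimately have "algebraic_int (3 * - u)" by (rule coeff)
    thus ?thesis by simp
  qed
  moreover have "3 * u \<in> pure_cubic_field" "3 * v \<in> pure_cubic_field"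
    using cubic.mult_mem[OF cubic.of_nat_mem[of 3]] uv(2,3) by simp_all
  ultimately obtain a b c d e f where
    u9: "3 * (3 * u) = of_int a + of_int b * cbrt2 + of_int c * cbrt2 ^ 2" and
    v9: "3 * (3 * v) = of_int d + of_int e * cbrt2 + of_int f * cbrt2 ^ 2"
    using three_times_pure_cubic_integer[of "3 * u"] three_times_pure_cubic_integer[of "3 * v"] by blast
  have "9 * x = 3 * (3 * u) + 3 * (3 * v) * omega" by (simp add: uv(1) algebra_simps)
  hence "9 * x = lattice_point a b c d e f" unfolding lattice_point_def cubic_point_def u9 v9 .
  thus ?thesis by blast
qed

lemma coprime_nine_prime:
  assumes "prime p" "p \<noteq> 3"
  shows "coprime 9 (int p)"
proof -
  have "coprime 3 p" using assms by (simp add: primes_coprime)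
  hence "coprime (3 ^ 2) p" by (simp only: coprime_power_left_iff simp_thms)
  hence "coprime (int (3 ^ 2)) (int p)" by (simp only: coprime_int_iff)
  thus ?thesis by simp
qed

text \<open>As 9 is invertible modulo \<open>p\<close>, every integer is congruent modulo \<open>p\<close> to a lattice point with
coefficients below \<open>p\<close>.\<close>

lemma closure_finite_residues:
  assumes p: "prime p" "p \<noteq> 3"
  shows "closure.finite_residues p"
proof -
  have "coprime 9 (int p)" using coprime_nine_prime p by blast
  then obtain s t where "s * 9 + t * int p = 1"
    by (metis bezout_int coprime_imp_gcd_eq_1)
  hence "of_int (s * 9 + t * int p) = (1 :: complex)" by simp
  hence st: "of_int s * 9 = (1 - of_int t * of_nat p :: complex)"
    by (simp add: algebra_simps)
  let ?I = "{0..<int p}"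
  let ?T = "(\<lambda>(a, b, c, d, e, f). lattice_point a b c d e f) ` (?I \<times> ?I \<times> ?I \<times> ?I \<times> ?I \<times> ?I)"
  have p0: "int p > 0" using prime_gt_0_nat[OF p(1)] by simp
  have "\<exists>y\<in>?T. algebraic_int ((x - y) / of_nat p)" if x: "x \<in> carrier (ring_of_integers cubic_closure)" for x
  proof -
    have xi: "algebraic_int x" using x by simp
    obtain a b c d e f where l: "9 * x = lattice_point a b c d e f"
      using nine_times_closure_integer[of x] x by auto
    let ?r = "\<lambda>a. (s * a) mod int p" and ?q = "\<lambda>a. (s * a) div int p"
    have dm: "s * a = ?r a + int p * ?q a" for a
      by (rule mod_mult_div_eq[symmetric])
    let ?y = "lattice_point (?r a) (?r b) (?r c) (?r d) (?r e) (?r f)"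
    let ?w = "lattice_point (?q a) (?q b) (?q c) (?q d) (?q e) (?q f)"
    have "x - of_int t * of_nat p * x = (of_int s * 9) * x"
      unfolding st by (simp add: left_diff_distrib)
    also have "\<dots> = of_int s * lattice_point a b c d e f"
      by (simp add: l mult.assoc)
    also have "\<dots> = lattice_point (?r a + int p * ?q a) (?r b + int p * ?q b) (?r c + int p * ?q c)
        (?r d + int p * ?q d) (?r e + int p * ?q e) (?r f + int p * ?q f)"
      unfolding lattice_point_scale[symmetric] dm[symmetric] ..
    also have "\<dots> = ?y + of_nat p * ?w"
      unfolding lattice_point_add lattice_point_scale of_int_of_nat_eq ..
    finally have "x - of_int t * of_nat p * x = ?y + of_nat p * ?w" .
    hence "x - ?y = of_nat p * (?w + of_int t * x)"
      by (simp add: algebra_simps del: of_int_mult)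
    hence "(x - ?y) / of_nat p = ?w + of_int t * x"
      using p0 by simp
    hence "algebraic_int ((x - ?y) / of_nat p)"
      by (simp only:) (intro algebraic_int_intros xi algebraic_int_lattice_point algebraic_int_of_int)
    moreover have "?y \<in> ?T"
      using p0 by (intro image_eqI[of _ _ "(?r a, ?r b, ?r c, ?r d, ?r e, ?r f)"]) (simp_all only: prod.case mem_Sigma_iff atLeastLessThan_iff pos_mod_sign pos_mod_bound simp_thms)
    ultimately show ?thesis by (rule bexI)
  qed
  moreover have "finite ?T"
    by (intro finite_imageI finite_cartesian_product finite_atLeastLessThan_int)
  ultimately show ?thesis
    unfolding closure.finite_residues_def by (intro exI[of _ ?T] conjI ballI)
qed

lemma pure_cubic_finite_residues:
  assumes "prime p" "p \<noteq> 3"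
  shows "cubic.finite_residues p"
proof -
  obtain T where T: "finite T"
    "\<forall>x\<in>carrier (ring_of_integers cubic_closure). \<exists>t\<in>T. algebraic_int ((x - t) / of_nat p)"
    using closure_finite_residues[OF assms] unfolding closure.finite_residues_def by (elim exE conjE)
  have "carrier (ring_of_integers pure_cubic_field) \<subseteq> carrier (ring_of_integers cubic_closure)"
    using pure_cubic_subset_closure by auto
  hence "\<forall>x\<in>carrier (ring_of_integers pure_cubic_field). \<exists>t\<in>T. algebraic_int ((x - t) / of_nat p)"
    using T(2) by blast
  thus ?thesis unfolding cubic.finite_residues_def using T(1) by (intro exI[of _ T] conjI)
qed

section \<open>Frobenius at primes other than 2 and 3\<close>

text \<open>Congruence modulo \<open>p\<close> in the ring of all algebraic integers, so that no particular field needs to be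
mentioned.\<close>

definition cong_alg :: "nat \<Rightarrow> complex \<Rightarrow> complex \<Rightarrow> bool" where
  "cong_alg p x y \<longleftrightarrow> algebraic_int ((x - y) / of_nat p)"

lemma cong_alg_refl [simp]: "cong_alg p x x"
  by (simp add: cong_alg_def)

lemma cong_alg_sym: "cong_alg p x y \<Longrightarrow> cong_alg p y x"
  using algebraic_int_minus[of "(x - y) / of_nat p"] by (simp add: cong_alg_def minus_divide_left)

lemma cong_alg_trans [trans]: "cong_alg p x y \<Longrightarrow> cong_alg p y z \<Longrightarrow> cong_alg p x z"
  using algebraic_int_plus_times(1)[of "(x - y) / of_nat p" "(y - z) / of_nat p"]
  by (simp add: cong_alg_def flip: add_divide_distrib)

lemma cong_alg_add: "cong_alg p x y \<Longrightarrow> cong_alg p x' y' \<Longrightarrow> cong_alg p (x + x') (y + y')"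
  using algebraic_int_plus_times(1)[of "(x - y) / of_nat p" "(x' - y') / of_nat p"]
  by (simp add: cong_alg_def algebra_simps flip: add_divide_distrib)

lemma cong_alg_scale: "cong_alg p x y \<Longrightarrow> algebraic_int z \<Longrightarrow> cong_alg p (z * x) (z * y)"
  using algebraic_int_plus_times(2)[of z "(x - y) / of_nat p"]
  by (simp add: cong_alg_def algebra_simps)

lemma cong_alg_mult:
  assumes "cong_alg p x y" "cong_alg p x' y'" "algebraic_int x" "algebraic_int y'"
  shows "cong_alg p (x * x') (y * y')"
proof -
  have "cong_alg p (x * x') (x * y')" using assms by (intro cong_alg_scale)
  also have "cong_alg p (x * y') (y * y')"
    using cong_alg_scale[OF assms(1,4)] by (simp add: mult.commute)
  finally show ?thesis .
qed

lemma cong_alg_power: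
  assumes "cong_alg p x y" "algebraic_int x" "algebraic_int y"
  shows "cong_alg p (x ^ n) (y ^ n)"
  using assms by (induction n) (auto intro!: cong_alg_mult algebraic_int_power)

lemma cong_alg_cancel:
  assumes "cong_alg p (of_int m * x) (of_int m * y)" "coprime m (int p)" "p > 0"
    "algebraic_int x" "algebraic_int y"
  shows "cong_alg p x y"
proof -
  obtain s t where "s * m + t * int p = 1"
    using assms(2) by (metis bezout_int coprime_imp_gcd_eq_1)
  hence "of_int (s * m + t * int p) = (1 :: complex)" by (simp only: of_int_1)
  hence st: "of_int s * of_int m + of_int t * of_nat p = (1 :: complex)"
    by (simp only: of_int_add of_int_mult of_int_of_nat_eq)
  have arith: "(x - y) / P = S * ((M * x - M * y) / P) + T * (x - y)"
    if "P \<noteq> 0" "S * M + T * P = 1" for S M T P :: complex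
  proof -
    have "(x - y) / P = (S * M + T * P) * (x - y) / P" by (simp only: that(2) mult_1)
    thus ?thesis using that(1) by (simp add: field_simps)
  qed
  have eq: "(x - y) / of_nat p = of_int s * ((of_int m * x - of_int m * y) / of_nat p) + of_int t * (x - y)"
    by (rule arith[OF _ st]) (use assms(3) in simp)
  show ?thesis
    unfolding cong_alg_def eq
    by (intro algebraic_int_plus_times algebraic_int_diff algebraic_int_of_int assms(4,5)
        assms(1)[unfolded cong_alg_def])
qed

lemma algebraic_int_sum:
  assumes "\<And>k. k \<in> A \<Longrightarrow> algebraic_int (f k :: complex)"
  shows "algebraic_int (\<Sum>k\<in>A. f k)"
  using assms by (induction A rule: infinite_finite_induct) (auto intro: algebraic_int_plus_times)

text \<open>The inner binomial coefficients of a prime exponent are divisible by that prime.\<close>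

lemma cong_alg_prime_power_add:
  assumes p: "prime p" and x: "algebraic_int x" and y: "algebraic_int y"
  shows "cong_alg p ((x + y) ^ (p ^ n)) (x ^ (p ^ n) + y ^ (p ^ n))"
proof (induction n)
  case (Suc n)
  have one: "cong_alg p ((a + b) ^ p) (a ^ p + b ^ p)"
    if ab: "algebraic_int a" "algebraic_int b" for a b
  proof -
    have p0: "p > 0" using prime_gt_0_nat[OF p] .
    have "(a + b) ^ p = (\<Sum>k\<le>p. of_nat (p choose k) * a ^ k * b ^ (p - k))"
      by (rule binomial_ring)
    also have "{..p} = insert 0 (insert p {0<..<p})" using p0 by auto
    also have "(\<Sum>k\<in>\<dots>. of_nat (p choose k) * a ^ k * b ^ (p - k)) =
        b ^ p + (a ^ p + (\<Sum>k\<in>{0<..<p}. of_nat (p choose k) * a ^ k * b ^ (p - k)))"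
      using p0 by simp
    finally have eq: "((a + b) ^ p - (a ^ p + b ^ p)) / of_nat p =
        (\<Sum>k\<in>{0<..<p}. of_nat (p choose k) * a ^ k * b ^ (p - k) / of_nat p)"
      by (simp add: sum_divide_distrib)
    have "algebraic_int (of_nat (p choose k) * a ^ k * b ^ (p - k) / of_nat p)" if k: "k \<in> {0<..<p}" for k
    proof -
      have "p dvd (p choose k)" using k p by (intro dvd_choose_prime) auto
      then obtain r where "p choose k = p * r" by blast
      hence "of_nat (p choose k) * a ^ k * b ^ (p - k) / of_nat p = of_nat r * a ^ k * b ^ (p - k)"
        using p0 by simp
      thus ?thesis using ab by (auto intro!: algebraic_int_intros)
    qed
    thus ?thesis unfolding cong_alg_def eq by (rule algebraic_int_sum)
  qed
  let ?q = "p ^ n"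
  have pow: "z ^ (p ^ Suc n) = (z ^ ?q) ^ p" for z :: complex
    by (simp add: power_mult[symmetric] mult.commute)
  have "cong_alg p (((x + y) ^ ?q) ^ p) ((x ^ ?q + y ^ ?q) ^ p)"
    using x y Suc.IH by (intro cong_alg_power algebraic_int_intros)
  also have "cong_alg p ((x ^ ?q + y ^ ?q) ^ p) ((x ^ ?q) ^ p + (y ^ ?q) ^ p)"
    using x y by (intro one algebraic_int_intros)
  finally show ?case unfolding pow .
qed simp

text \<open>The elements with this property form a subring; computations with it therefore reduce to generators.\<close>

definition frobenius_fixed :: "nat \<Rightarrow> nat \<Rightarrow> complex \<Rightarrow> bool" where
  "frobenius_fixed p n x \<longleftrightarrow> algebraic_int x \<and> cong_alg p (x ^ (p ^ n)) x"

lemma frobenius_fixed_add: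
  assumes "prime p" "frobenius_fixed p n x" "frobenius_fixed p n y"
  shows "frobenius_fixed p n (x + y)"
  using assms cong_alg_trans[OF cong_alg_prime_power_add[of p x y n] cong_alg_add]
  by (auto simp: frobenius_fixed_def intro: algebraic_int_intros)

lemma frobenius_fixed_mult:
  assumes "frobenius_fixed p n x" "frobenius_fixed p n y"
  shows "frobenius_fixed p n (x * y)"
  using assms cong_alg_mult[of p "x ^ (p ^ n)" x "y ^ (p ^ n)" y]
  by (auto simp: frobenius_fixed_def power_mult_distrib intro: algebraic_int_intros)

lemma frobenius_fixed_power:
  assumes "frobenius_fixed p n x"
  shows "frobenius_fixed p n (x ^ k)"
proof (induction k)
  case (Suc k)
  thus ?case using frobenius_fixed_mult[OF assms] by simp
qed (simp add: frobenius_fixed_def)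

text \<open>Fermat's little theorem follows by adding ones; oddness of \<open>p\<close> serves for the sign.\<close>

lemma frobenius_fixed_of_int:
  assumes p: "prime p" "odd p"
  shows "frobenius_fixed p n (of_int m)"
proof -
  have nat: "frobenius_fixed p n (of_nat k)" for k
  proof (induction k)
    case 0
    show ?case using prime_gt_0_nat[OF p(1)] by (simp add: frobenius_fixed_def power_0_left)
  next
    case (Suc k)
    have "frobenius_fixed p n 1" by (simp add: frobenius_fixed_def)
    thus ?case using frobenius_fixed_add[OF p(1)] Suc by simp
  qed
  have "frobenius_fixed p n (-1)"
    using p(2) algebraic_int_of_int[of "-1"] by (simp add: frobenius_fixed_def)
  hence "frobenius_fixed p n (- of_nat k)" for k
    using frobenius_fixed_mult[of p n "-1" "of_nat k"] nat by simp
  thus ?thesis using nat by (cases m rule: int_cases2) auto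
qed

lemma frobenius_fixed_closure:
  assumes p: "prime p" "p \<noteq> 2" "p \<noteq> 3"
    and gen: "frobenius_fixed p n cbrt2" "frobenius_fixed p n omega"
    and x: "x \<in> cubic_closure" "algebraic_int x"
  shows "frobenius_fixed p n x"
proof -
  have odd: "odd p" using p primes_dvd_imp_eq[OF two_is_prime_nat p(1)] by blast
  obtain a b c d e f where l: "9 * x = lattice_point a b c d e f"
    using nine_times_closure_integer[OF x] by blast
  have "frobenius_fixed p n (lattice_point a b c d e f)"
    unfolding lattice_point_def cubic_point_def
    by (intro frobenius_fixed_add frobenius_fixed_mult frobenius_fixed_power frobenius_fixed_of_int gen p(1) odd)
  hence "cong_alg p ((9 * x) ^ (p ^ n)) (9 * x)"
    unfolding frobenius_fixed_def l by (rule conjunct2)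
  hence 1: "cong_alg p (9 ^ (p ^ n) * x ^ (p ^ n)) (9 * x)"
    unfolding power_mult_distrib .
  have "cong_alg p (9 ^ (p ^ n)) 9"
    using frobenius_fixed_of_int[OF p(1) odd, of n 9] by (simp add: frobenius_fixed_def)
  hence "cong_alg p (x ^ (p ^ n) * 9) (x ^ (p ^ n) * 9 ^ (p ^ n))"
    by (intro cong_alg_scale algebraic_int_power x(2)) (rule cong_alg_sym)
  hence "cong_alg p (9 * x ^ (p ^ n)) (9 ^ (p ^ n) * x ^ (p ^ n))"
    by (simp only: mult.commute)
  hence "cong_alg p (9 * x ^ (p ^ n)) (9 * x)" using 1 by (rule cong_alg_trans)
  hence "cong_alg p (of_int 9 * x ^ (p ^ n)) (of_int 9 * x)" by (simp only: of_int_numeral)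
  moreover have "coprime 9 (int p)" using coprime_nine_prime p by blast
  ultimately have "cong_alg p (x ^ (p ^ n)) x"
    by (rule cong_alg_cancel) (use x(2) prime_gt_0_nat[OF p(1)] in \<open>simp_all add: algebraic_int_power\<close>)
  thus ?thesis using x(2) by (simp add: frobenius_fixed_def)
qed

lemma power_in_pure_cubic_basis:
  "\<exists>a\<in>\<rat>. \<exists>b\<in>\<rat>. \<exists>c\<in>\<rat>. \<forall>z :: complex. z ^ 3 = 2 \<longrightarrow> z ^ k = a + b * z + c * z ^ 2"
proof (induction k)
  case 0
  show ?case by (intro bexI[of _ 1] bexI[of _ 0]) simp_all
next
  case (Suc k)
  then obtain a b c :: complex where abc: "a \<in> \<rat>" "b \<in> \<rat>" "c \<in> \<rat>"
    "\<And>z. z ^ 3 = 2 \<Longrightarrow> z ^ k = a + b * z + c * z ^ 2" by blast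
  have "z ^ Suc k = 2 * c + a * z + b * z ^ 2" if z: "z ^ 3 = 2" for z
  proof -
    have "z * (a + b * z + c * z ^ 2) = z ^ 3 * c + a * z + b * z ^ 2"
      by (simp add: algebra_simps power2_eq_square power3_eq_cube)
    thus ?thesis unfolding z by (simp only: power_Suc abc(4)[OF z])
  qed
  thus ?case using abc(1-3) by (intro bexI[of _ "2 * c"] bexI[of _ a] bexI[of _ b]) simp_all
qed

text \<open>Conjugating the algebraic integer \<open>(\<alpha> ^ p ^ n - \<alpha>) / p\<close> shows the congruence for \<open>\<omega>\<alpha>\<close>. Comparing it
with the one for \<open>\<alpha>\<close> and multiplying by \<open>\<alpha>\<^sup>2\<close> gives \<open>2 \<omega> ^ p ^ n \<equiv> 2 \<omega>\<close>, and 2 is invertible modulo \<open>p\<close>.\<close>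

lemma frobenius_fixed_omega_if_cbrt2:
  assumes p: "prime p" "p \<noteq> 2" and fix_cbrt2: "frobenius_fixed p n cbrt2"
  shows "frobenius_fixed p n omega"
proof -
  let ?q = "p ^ n"
  have p0: "p > 0" using prime_gt_0_nat[OF p(1)] .
  obtain a b c :: complex where abc: "a \<in> \<rat>" "b \<in> \<rat>" "c \<in> \<rat>" "\<And>z. z ^ 3 = 2 \<Longrightarrow> z ^ ?q = a + b * z + c * z ^ 2"
    using power_in_pure_cubic_basis[of ?q] by blast
  have quot: "(z ^ ?q - z) / of_nat p = a / of_nat p + (b - 1) / of_nat p * z + c / of_nat p * z ^ 2"
    if "z ^ 3 = 2" for z
  proof -
    have "(a + b * z + c * z ^ 2 - z) / P = a / P + (b - 1) / P * z + c / P * z ^ 2" for P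
      by (simp add: diff_divide_distrib add_divide_distrib left_diff_distrib)
    thus ?thesis unfolding abc(4)[OF that] .
  qed
  have z: "(omega * cbrt2) ^ 3 = 2" by (simp add: power_mult_distrib)
  have "algebraic_int (a / of_nat p + (b - 1) / of_nat p * cbrt2 + c / of_nat p * cbrt2 ^ 2)"
    using fix_cbrt2 unfolding frobenius_fixed_def cong_alg_def quot[OF cbrt2_cube] by (rule conjunct2)
  hence "algebraic_int (a / of_nat p + (b - 1) / of_nat p * (omega * cbrt2) + c / of_nat p * (omega * cbrt2) ^ 2)"
    by (intro algebraic_int_conjugate[OF _ _ _ _ z] Rats_divide Rats_diff abc(1-3) Rats_1 Rats_of_nat)
  hence "cong_alg p ((omega * cbrt2) ^ ?q) (omega * cbrt2)"
    unfolding cong_alg_def quot[OF z] .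
  hence 1: "cong_alg p (omega ^ ?q * cbrt2 ^ ?q) (omega * cbrt2)"
    by (simp only: power_mult_distrib)
  have 2: "cong_alg p (omega ^ ?q * cbrt2) (omega ^ ?q * cbrt2 ^ ?q)"
    using fix_cbrt2 unfolding frobenius_fixed_def
    by (intro cong_alg_scale[OF cong_alg_sym] algebraic_int_power) auto
  have "cong_alg p (cbrt2 ^ 2 * (omega ^ ?q * cbrt2)) (cbrt2 ^ 2 * (omega * cbrt2))"
    by (rule cong_alg_scale[OF cong_alg_trans[OF 2 1]]) (auto intro: algebraic_int_power)
  moreover have "cbrt2 ^ 2 * (y * cbrt2) = of_int 2 * y" for y
  proof -
    have "cbrt2 ^ 2 * (y * cbrt2) = cbrt2 ^ 3 * y" by (simp add: power2_eq_square power3_eq_cube)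
    thus ?thesis by simp
  qed
  ultimately have "cong_alg p (of_int 2 * omega ^ ?q) (of_int 2 * omega)" by (simp only:)
  moreover have "coprime 2 (int p)"
  proof -
    have "coprime 2 p"
      by (rule primes_coprime[OF two_is_prime_nat p(1)]) (use p(2) in simp)
    hence "coprime (int 2) (int p)" by (simp only: coprime_int_iff)
    thus ?thesis by simp
  qed
  ultimately have "cong_alg p (omega ^ ?q) omega"
    by (rule cong_alg_cancel) (use p0 in \<open>simp_all add: algebraic_int_power\<close>)
  thus ?thesis unfolding frobenius_fixed_def by simp
qed

text \<open>In \<open>p ^ 6 - 1 = (p - 1) (1 + p) (1 + p\<^sup>2 + p\<^sup>4)\<close>, the number 3 divides the second factor if
\<open>p mod 3 = 2\<close>, and the third one if \<open>p mod 3 = 1\<close>.\<close>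

lemma three_times_pred_dvd_sixth_power_minus_one:
  assumes "prime p" "p \<noteq> 3"
  shows "3 * (p - 1) dvd p ^ 6 - (1 :: nat)"
proof -
  have "3 dvd ((1 + int p) * (1 + int p ^ 2 + int p ^ 4))"
  proof -
    have "\<not> 3 dvd p" using assms by (auto simp: prime_nat_iff)
    hence "int p mod 3 = 1 \<or> int p mod 3 = 2" by presburger
    thus ?thesis
    proof
      assume "int p mod 3 = 2"
      hence "3 dvd (1 + int p)" by presburger
      thus ?thesis by (rule dvd_mult2)
    next
      assume "int p mod 3 = 1"
      then obtain k where k: "int p = 1 + 3 * k"
        by (metis add.commute mult_div_mod_eq)
      have "1 + int p ^ 2 + int p ^ 4 = 3 * (1 + 6 * k + 21 * k ^ 2 + 36 * k ^ 3 + 27 * k ^ 4)"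
        unfolding k by (simp add: eval_nat_numeral algebra_simps)
      hence "3 dvd 1 + int p ^ 2 + int p ^ 4" by (rule dvdI)
      thus ?thesis by (rule dvd_mult)
    qed
  qed
  then obtain m where m: "(1 + int p) * (1 + int p ^ 2 + int p ^ 4) = 3 * m" by blast
  have "int p ^ 6 - 1 = (int p - 1) * ((1 + int p) * (1 + int p ^ 2 + int p ^ 4))"
    by (simp add: algebra_simps eval_nat_numeral)
  hence "int p ^ 6 - 1 = 3 * (int p - 1) * m" unfolding m by simp
  hence "3 * (int p - 1) dvd int p ^ 6 - 1" by simp
  moreover have "int (3 * (p - 1)) = 3 * (int p - 1)" "int (p ^ 6 - 1) = int p ^ 6 - 1"
    using prime_gt_0_nat[OF assms(1)] by (simp_all add: of_nat_diff)
  ultimately show ?thesis by (metis int_dvd_int_iff)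
qed

text \<open>By Fermat's little theorem \<open>\<alpha> ^ (3 * (p - 1)) = 2 ^ (p - 1) \<equiv> 1\<close>, and \<open>3 * (p - 1)\<close> divides \<open>p ^ 6 - 1\<close>.\<close>

lemma frobenius_fixed_six:
  assumes p: "prime p" "p \<noteq> 2" "p \<noteq> 3"
  shows "frobenius_fixed p 6 cbrt2"
proof -
  have p0: "p > 0" using prime_gt_0_nat[OF p(1)] .
  obtain k where k: "p ^ 6 - 1 = 3 * (p - 1) * k"
    using three_times_pred_dvd_sixth_power_minus_one[OF p(1,3)] by blast
  have "\<not> p dvd 2" using p by (metis primes_dvd_imp_eq two_is_prime_nat)
  hence "p dvd 2 ^ (p - 1) - 1"
    using fermat_theorem[OF p(1), of 2] cong_to_1_nat by blast
  then obtain r where r: "2 ^ (p - 1) - 1 = p * r" by blast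
  have "(1::nat) \<le> 2 ^ (p - 1)" by simp
  hence "2 ^ (p - 1) = 1 + p * r" using r by linarith
  hence "of_nat (2 ^ (p - 1)) = (of_nat (1 + p * r) :: complex)" by (simp only:)
  hence "cong_alg p (2 ^ (p - 1)) 1" using p0 by (simp add: cong_alg_def)
  hence "cong_alg p ((2 ^ (p - 1)) ^ k) (1 ^ k)"
    using algebraic_int_of_nat[of "2 ^ (p - 1)"] algebraic_int_of_nat[of 1] by (intro cong_alg_power) simp_all
  moreover have "cbrt2 ^ (p ^ 6 - 1) = (2 ^ (p - 1)) ^ k"
    unfolding k power_mult cbrt2_cube ..
  ultimately have "cong_alg p (cbrt2 * cbrt2 ^ (p ^ 6 - 1)) (cbrt2 * 1)"
    by (intro cong_alg_scale) simp_all
  moreover have "cbrt2 * cbrt2 ^ (p ^ 6 - 1) = cbrt2 ^ (p ^ 6)"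
    using p0 power_minus_mult[of "p ^ 6" cbrt2] by (simp only: mult.commute zero_less_power)
  ultimately show ?thesis by (simp add: frobenius_fixed_def)
qed

lemma frobenius_fixed_pure_cubic_imp_closure:
  assumes p: "prime p" "p \<noteq> 2" "p \<noteq> 3" and gen: "frobenius_fixed p n cbrt2"
    and x: "x \<in> cubic_closure" "algebraic_int x"
  shows "frobenius_fixed p n x"
  using frobenius_fixed_closure[OF p gen frobenius_fixed_omega_if_cbrt2[OF p(1,2) gen] x] .

text \<open>The two lcms are compared through their multiples: either of them divides \<open>n\<close> iff \<open>\<alpha>\<close> is fixed.\<close>

lemma lcm_splitting_type_eq:
  assumes p: "prime p" "p \<noteq> 2" "p \<noteq> 3"
  shows "lcm_mset (splitting_type pure_cubic_field p) = lcm_mset (splitting_type cubic_closure p)"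
proof -
  have q: "2 \<le> p ^ 6" using prime_ge_2_nat[OF p(1)] by (metis le_trans self_le_power zero_less_numeral one_le_numeral)
  have all6: "frobenius_fixed p 6 x" if "x \<in> cubic_closure" "algebraic_int x" for x
    using frobenius_fixed_pure_cubic_imp_closure[OF p frobenius_fixed_six[OF p] that] .
  have 1: "lcm_mset (splitting_type pure_cubic_field p) dvd n \<longleftrightarrow>
      (\<forall>x\<in>pure_cubic_field. algebraic_int x \<longrightarrow> frobenius_fixed p n x)" for n
  proof -
    have "\<forall>x\<in>carrier (ring_of_integers pure_cubic_field). algebraic_int ((x ^ (p ^ 6) - x) / of_nat p)"
      using all6 pure_cubic_subset_closure by (auto simp: frobenius_fixed_def cong_alg_def)
    from cubic.lcm_splitting_type_dvd_iff_frobenius[OF pure_cubic_finite_residues[OF p(1,3)] p(1) q this]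
    show ?thesis by (auto simp: frobenius_fixed_def cong_alg_def)
  qed
  have 2: "lcm_mset (splitting_type cubic_closure p) dvd n \<longleftrightarrow>
      (\<forall>x\<in>cubic_closure. algebraic_int x \<longrightarrow> frobenius_fixed p n x)" for n
  proof -
    have "\<forall>x\<in>carrier (ring_of_integers cubic_closure). algebraic_int ((x ^ (p ^ 6) - x) / of_nat p)"
      using all6 by (auto simp: frobenius_fixed_def cong_alg_def)
    from closure.lcm_splitting_type_dvd_iff_frobenius[OF closure_finite_residues[OF p(1,3)] p(1) q this]
    show ?thesis by (auto simp: frobenius_fixed_def cong_alg_def)
  qed
  have "lcm_mset (splitting_type pure_cubic_field p) dvd n \<longleftrightarrow>
      lcm_mset (splitting_type cubic_closure p) dvd n" for n
    unfolding 1 2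
  proof
    assume "\<forall>x\<in>pure_cubic_field. algebraic_int x \<longrightarrow> frobenius_fixed p n x"
    hence "frobenius_fixed p n cbrt2" using cbrt2_mem algebraic_int_cbrt2 by blast
    thus "\<forall>x\<in>cubic_closure. algebraic_int x \<longrightarrow> frobenius_fixed p n x"
      using frobenius_fixed_pure_cubic_imp_closure[OF p] by blast
  next
    assume "\<forall>x\<in>cubic_closure. algebraic_int x \<longrightarrow> frobenius_fixed p n x"
    thus "\<forall>x\<in>pure_cubic_field. algebraic_int x \<longrightarrow> frobenius_fixed p n x"
      using pure_cubic_subset_closure by blast
  qed
  from this[of "lcm_mset (splitting_type pure_cubic_field p)"] this[of "lcm_mset (splitting_type cubic_closure p)"]
  show ?thesis by (intro dvd_antisym) simp_all
qed

section \<open>The prime 2\<close>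

text \<open>As \<open>(1 + 2 \<omega>)\<^sup>2 = -3\<close>, the sixth power of the quotient is \<open>-27/4\<close>. Since \<open>1 + 2 \<omega> = \<omega> - cnj \<omega>\<close>, this
separates \<open>\<omega>\<close> from its conjugate modulo \<open>\<alpha>\<close>.\<close>

lemma one_plus_two_omega_not_divisible_by_cbrt2: "\<not> algebraic_int ((1 + 2 * omega) / cbrt2)"
proof
  assume int: "algebraic_int ((1 + 2 * omega) / cbrt2)"
  have "(1 + 2 * omega) ^ 2 = 1 + 4 * omega + 4 * omega ^ 2"
    by (simp add: power2_eq_square algebra_simps)
  hence "(1 + 2 * omega) ^ 2 = -3" unfolding omega_square by simp
  hence "((1 + 2 * omega) ^ 2) ^ 3 = (-3) ^ 3" by (simp only:)
  hence a: "(1 + 2 * omega) ^ 6 = -27" unfolding power_mult[symmetric] by simp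
  have "(cbrt2 ^ 3) ^ 2 = 4" by simp
  hence b: "cbrt2 ^ 6 = 4" unfolding power_mult[symmetric] by simp
  have "((1 + 2 * omega) / cbrt2) ^ 6 = of_int (- 27) / of_nat 4"
    unfolding power_divide a b by simp
  hence "algebraic_int (of_int (- 27) / of_nat 4 :: complex)"
    using algebraic_int_power[OF int, of 6] by (simp only:)
  hence "int 4 dvd - 27" by (rule algebraic_int_quotient_imp_dvd) simp
  thus False by simp
qed

text \<open>Write \<open>x = 9 x - 8 x\<close>. The second term is divisible by \<open>\<alpha>\<^sup>9\<close>, and in the lattice point \<open>9 x\<close> only the
coefficients of 1 and \<open>\<omega>\<close> matter modulo \<open>\<alpha>\<close>, up to parity because \<open>2 = \<alpha>\<^sup>3\<close>.\<close>

lemma residue_mod_cbrt2: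
  assumes x: "x \<in> cubic_closure" "algebraic_int x"
  shows "\<exists>a\<in>{0, 1::int}. \<exists>d\<in>{0, 1::int}. \<exists>z\<in>cubic_closure. algebraic_int z \<and>
    x = of_int a + of_int d * omega + cbrt2 * z"
proof -
  obtain a b c d e f where l: "9 * x = lattice_point a b c d e f"
    using nine_times_closure_integer[OF x] by blast
  have parity: "\<exists>r\<in>{0, 1::int}. \<exists>q. a = r + 2 * q" for a :: int
    by (intro bexI[of _ "a mod 2"] exI[of _ "a div 2"]) auto
  obtain r q where a: "r \<in> {0, 1}" "a = r + 2 * q" using parity by blast
  obtain s t where d: "s \<in> {0, 1}" "d = s + 2 * t" using parity by blast
  define z where "z = cbrt2 ^ 2 * (of_int q + of_int t * omega) + of_int b + of_int c * cbrt2
      + (of_int e + of_int f * cbrt2) * omega - 4 * (cbrt2 ^ 2 * x)"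
  have arith: "C * (C ^ 2 * (q + t * w) + b + c * C + (e + f * C) * w - 4 * (C ^ 2 * x)) =
      C ^ 3 * q + (C ^ 3 * t) * w + (b * C + c * C ^ 2) + (e * C + f * C ^ 2) * w - 4 * C ^ 3 * x"
    for C q t b c e f w x :: complex
    by (simp add: algebra_simps power2_eq_square power3_eq_cube)
  have nine: "9 * x = of_int r + 2 * of_int q + (of_int b * cbrt2 + of_int c * cbrt2 ^ 2) +
      (of_int s + 2 * of_int t + (of_int e * cbrt2 + of_int f * cbrt2 ^ 2)) * omega"
    unfolding l lattice_point_def cubic_point_def a(2) d(2) by (simp add: add.assoc)
  have "cbrt2 * z = 9 * x - of_int r - of_int s * omega - 8 * x"
    unfolding z_def arith cbrt2_cube nine by (simp add: distrib_right)
  hence "x = of_int r + of_int s * omega + cbrt2 * z" by simp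
  moreover have "algebraic_int z"
    unfolding z_def using algebraic_int_of_nat[of 4]
    by (intro algebraic_int_intros algebraic_int_of_int algebraic_int_omega algebraic_int_cbrt2 x(2)) simp
  moreover have "z \<in> cubic_closure"
    unfolding z_def using closure.of_nat_mem[of 4]
    by (intro closure.add_mem closure.mult_mem closure.diff_mem closure.power_mem closure.of_int_mem omega_mem x(1)
        subsetD[OF pure_cubic_subset_closure cbrt2_mem]) simp
  ultimately show ?thesis using a(1) d(1) by blast
qed

text \<open>An integer \<open>x\<close> of the cubic field is real, so by comparison with its complex conjugate it is congruent
to 0 or 1 modulo \<open>\<alpha>\<close> in the closure. Hence \<open>x\<^sup>2 - x\<close> is a multiple of \<open>\<alpha>\<close> there, its cube is a multiple
of 2, and it lies in every prime containing 2.\<close>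

lemma lcm_splitting_type_pure_cubic_2: "lcm_mset (splitting_type pure_cubic_field 2) dvd 1"
proof -
  have "\<forall>P\<in>primes_above pure_cubic_field 2. \<forall>x\<in>carrier (ring_of_integers pure_cubic_field). x ^ 2 - x \<in> P"
  proof (intro ballI)
    fix P x assume P: "P \<in> primes_above pure_cubic_field 2"
      and x: "x \<in> carrier (ring_of_integers pure_cubic_field)"
    have prime: "primeideal P (ring_of_integers pure_cubic_field)" and two: "of_nat 2 \<in> P"
      using cubic.primes_above_subset[of 2] P by auto
    have xK: "x \<in> pure_cubic_field" and xi: "algebraic_int x" using x by auto
    have "x \<in> cubic_closure" using xK pure_cubic_subset_closure by blast
    then obtain a d z where *: "a \<in> {0, 1::int}" "d \<in> {0, 1::int}" "algebraic_int z"
        "x = of_int a + of_int d * omega + cbrt2 * z"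
      using residue_mod_cbrt2[of x] xi by blast
    have "d = 0"
    proof (rule ccontr)
      assume "d \<noteq> 0"
      hence d: "d = 1" using *(2) by simp
      have x1: "x = of_int a + omega + cbrt2 * z" using *(4) by (simp add: d)
      have "cnj x = of_int a + (-1 - omega) + cbrt2 * cnj z" unfolding x1 by simp
      hence x2: "x = of_int a + (-1 - omega) + cbrt2 * cnj z" unfolding cnj_pure_cubic[OF xK] .
      have "1 + 2 * w = (A + w + C * z) - (A + (-1 - w) + C * z') + C * (z' - z)" for w A C z z' :: complex
        by (simp add: right_diff_distrib)
      from this[of omega "of_int a" cbrt2 z "cnj z", folded x1 x2]
      have "1 + 2 * omega = cbrt2 * (cnj z - z)" by simp
      hence "(1 + 2 * omega) / cbrt2 = cnj z - z" by simp
      moreover have "algebraic_int (cnj z - z)" using *(3) by (intro algebraic_int_diff) auto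
      ultimately have "algebraic_int ((1 + 2 * omega) / cbrt2)" by (rule ssubst)
      thus False using one_plus_two_omega_not_divisible_by_cbrt2 by contradiction
    qed
    hence x_eq: "x = of_int a + cbrt2 * z" using *(4) by simp
    define w where "w = (2 * of_int a - 1) * z + cbrt2 * z ^ 2"
    have arith: "(A + C * z) ^ 2 - (A + C * z) = (A ^ 2 - A) + C * ((2 * A - 1) * z + C * z ^ 2)" for A C z :: complex
      by (simp add: power2_eq_square algebra_simps)
    have "(of_int a) ^ 2 - of_int a = (0 :: complex)" using *(1) by auto
    hence "x ^ 2 - x = cbrt2 * w" unfolding x_eq w_def arith by simp
    hence cube: "(x ^ 2 - x) ^ 3 / of_nat 2 = w ^ 3" by (simp add: power_mult_distrib)
    have "algebraic_int w"
      unfolding w_def using algebraic_int_of_int[of "2 * a - 1"] *(3)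
      by (intro algebraic_int_intros) simp_all
    hence "algebraic_int ((x ^ 2 - x) ^ 3 / of_nat 2)" unfolding cube by (rule algebraic_int_power)
    moreover have y: "x ^ 2 - x \<in> pure_cubic_field" "algebraic_int (x ^ 2 - x)"
      using xK xi by (auto intro: algebraic_int_intros)
    ultimately have "(x ^ 2 - x) ^ 3 \<in> P"
      by (intro cubic.ideal_mem_if_divisible[OF primeideal.axioms(1)[OF prime] two] cubic.power_mem) simp_all
    moreover have "(x ^ 2 - x) ^ 3 = (x ^ 2 - x) * ((x ^ 2 - x) * (x ^ 2 - x))"
      by (rule power3_eq_cube[unfolded mult.assoc])
    ultimately have "(x ^ 2 - x) * ((x ^ 2 - x) * (x ^ 2 - x)) \<in> P" by (simp only:)
    hence "x ^ 2 - x \<in> P \<or> (x ^ 2 - x) * (x ^ 2 - x) \<in> P"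
      by (rule cubic.prime_ideal_mult[OF prime _ y cubic.mult_mem[OF y(1) y(1)] algebraic_int_plus_times(2)[OF y(2) y(2)]])
    thus "x ^ 2 - x \<in> P"
      using cubic.prime_ideal_mult[OF prime _ y y] by (elim disjE) auto
  qed
  hence "\<forall>P\<in>primes_above pure_cubic_field 2. \<forall>x\<in>carrier (ring_of_integers pure_cubic_field). x ^ (2 ^ 1) - x \<in> P"
    by (simp only: power_one_right)
  moreover have "cubic.finite_residues 2"
    by (rule pure_cubic_finite_residues) auto
  ultimately show ?thesis
    by (intro iffD2[OF cubic.lcm_splitting_type_dvd_iff]) auto
qed

lemma (in complex_subfield) ideal_prod_principal:
  assumes "a \<in> carrier R" "b \<in> carrier R"
  shows "(PIdl\<^bsub>R\<^esub> a) \<cdot>\<^bsub>R\<^esub> (PIdl\<^bsub>R\<^esub> b) = PIdl\<^bsub>R\<^esub> (a * b)"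
proof -
  have idl: "ideal (PIdl\<^bsub>R\<^esub> (a * b)) R"
    using R.cgenideal_ideal[of "a * b"] assms by (auto intro: algebraic_int_plus_times)
  have "(PIdl\<^bsub>R\<^esub> a) \<cdot>\<^bsub>R\<^esub> (PIdl\<^bsub>R\<^esub> b) = genideal R (PIdl\<^bsub>R\<^esub> (a * b))"
    using R.ideal_prod_eq_genideal[OF R.cgenideal_ideal[OF assms(1)] R.cgenideal_ideal[OF assms(2)]]
      R.cgenideal_prod[OF assms] by simp
  also have "\<dots> = PIdl\<^bsub>R\<^esub> (a * b)"
    using R.genideal_minimal[OF idl order_refl] R.genideal_self[OF additive_subgroup.a_subset[OF ideal.axioms(1)[OF idl]]]
    by blast
  finally show ?thesis .
qed

text \<open>Modulo \<open>\<alpha>\<close> an integer is congruent to 0 or to one of 1, \<open>\<omega>\<close>, \<open>1 + \<omega>\<close>, which are units. So \<open>\<alpha>\<close> generates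
a prime ideal, and its cube \<open>\<alpha>\<^sup>3 = 2\<close> is a factorization of the ideal of 2.\<close>

lemma cbrt2_prime_above_2: "PIdl\<^bsub>ring_of_integers cubic_closure\<^esub> cbrt2 \<in> primes_above cubic_closure 2"
proof -
  let ?R = "ring_of_integers cubic_closure"
  let ?P = "PIdl\<^bsub>?R\<^esub> cbrt2"
  have cL: "cbrt2 \<in> carrier ?R" using subsetD[OF pure_cubic_subset_closure cbrt2_mem] by simp
  have oL: "omega \<in> carrier ?R" using omega_mem by simp
  have idl: "ideal ?P ?R" using closure.R.cgenideal_ideal[OF cL] .
  have mem: "x \<in> ?P \<longleftrightarrow> (\<exists>r. r \<in> cubic_closure \<and> algebraic_int r \<and> x = r * cbrt2)" for x
    unfolding closure.principal_ideal_eq by auto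
  have prime: "primeideal ?P ?R"
  proof (rule primeidealI[OF idl closure.R.is_cring])
    show "carrier ?R \<noteq> ?P"
    proof
      assume eq: "carrier ?R = ?P"
      have "algebraic_int (1 + of_int 2 * omega)"
        by (intro algebraic_int_plus_times algebraic_int_of_int algebraic_int_omega) simp
      moreover have "1 + of_int 2 * omega \<in> cubic_closure"
        by (intro closure.add_mem closure.mult_mem closure.one_mem closure.of_int_mem omega_mem)
      ultimately have "1 + 2 * omega \<in> carrier ?R" by simp
      hence "1 + 2 * omega \<in> ?P" unfolding eq .
      then obtain r where "algebraic_int r" "1 + 2 * omega = r * cbrt2" unfolding mem by blast
      thus False using one_plus_two_omega_not_divisible_by_cbrt2 by simp
    qed
    fix x y assume xy: "x \<in> carrier ?R" "y \<in> carrier ?R" "x \<otimes>\<^bsub>?R\<^esub> y \<in> ?P"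
    have x: "x \<in> cubic_closure" "algebraic_int x" and y: "y \<in> cubic_closure" "algebraic_int y"
      using xy by auto
    obtain a d z where *: "a \<in> {0, 1::int}" "d \<in> {0, 1::int}" "z \<in> cubic_closure" "algebraic_int z"
        "x = of_int a + of_int d * omega + cbrt2 * z"
      using residue_mod_cbrt2[OF x] by blast
    show "x \<in> ?P \<or> y \<in> ?P"
    proof (cases "a = 0 \<and> d = 0")
      case True
      hence "x = z * cbrt2" using *(5) by simp
      hence "x \<in> ?P" unfolding mem using *(3,4) by blast
      thus ?thesis ..
    next
      case False
      have w2: "omega * omega ^ 2 = 1" using omega_cube unfolding power3_eq_cube power2_eq_square mult.assoc .
      have "\<exists>u\<in>carrier ?R. u * (of_int a + of_int d * omega) = 1"
      proof -
        consider "a = 1" "d = 0" | "a = 0" "d = 1" | "a = 1" "d = 1" using *(1,2) False by auto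
        thus ?thesis
        proof cases
          case 1
          thus ?thesis using closure.R.one_closed by (intro bexI[of _ 1]) auto
        next
          case 2
          have "omega ^ 2 \<in> carrier ?R" using oL by (auto intro: algebraic_int_power)
          moreover have "omega ^ 2 * (of_int a + of_int d * omega) = 1"
            using w2 by (simp add: 2 mult.commute[of "omega ^ 2"])
          ultimately show ?thesis by (rule bexI[rotated])
        next
          case 3
          have "- omega * (1 + omega) = - omega - omega ^ 2"
            by (simp add: power2_eq_square distrib_left)
          hence "- omega * (1 + omega) = 1" unfolding omega_square by simp
          moreover have "- omega \<in> carrier ?R" using oL by auto
          ultimately show ?thesis using 3 by (intro bexI[of _ "- omega"]) auto
        qed
      qed
      then obtain u where u: "u \<in> carrier ?R" "u * (of_int a + of_int d * omega) = 1" by blast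
      have arith: "U * S * Y = U * ((S + C * Z) * Y) - (U * Y * Z) * C" for U S Y C Z :: complex
        by (simp add: algebra_simps)
      have "y = u * (of_int a + of_int d * omega) * y" unfolding u(2) by simp
      also have "\<dots> = u * (x * y) - (u * y * z) * cbrt2" unfolding arith[of u _ y cbrt2 z] *(5) ..
      also have "\<dots> \<in> ?P"
      proof (rule closure.ideal_diff[OF idl])
        show "u * (x * y) \<in> ?P" using closure.ideal_mult[OF idl, of "x * y" u] xy(3) u(1) by simp
        show "u * y * z * cbrt2 \<in> ?P"
          unfolding mem using u(1) y *(3,4)
          by (intro exI[of _ "u * y * z"] conjI closure.mult_mem algebraic_int_plus_times(2) refl) simp_all
      qed
      finally show ?thesis ..
    qed
  qed
  have fact: "prime_ideal_factorization ?R (PIdl\<^bsub>?R\<^esub> (of_nat 2)) {?P} (\<lambda>_. 3)"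
  proof -
    interpret I: comm_monoid "ideals_set ?R" by (rule closure.R.ideals_set_is_comm_monoid)
    have carr: "carrier (ideals_set ?R) = {I. ideal I ?R}" by (simp add: ideals_set_def)
    have mult: "I \<otimes>\<^bsub>ideals_set ?R\<^esub> J = I \<cdot>\<^bsub>?R\<^esub> J" for I J by (simp add: ideals_set_def)
    have PI: "?P \<in> carrier (ideals_set ?R)" using idl carr by blast
    have c2: "cbrt2 * cbrt2 \<in> carrier ?R" using closure.R.m_closed[OF cL cL] by simp
    have "?P [^]\<^bsub>ideals_set ?R\<^esub> (3::nat) = (?P \<cdot>\<^bsub>?R\<^esub> ?P) \<cdot>\<^bsub>?R\<^esub> ?P"
      unfolding numeral_3_eq_3 I.nat_pow_Suc I.nat_pow_0 mult I.l_one[OF PI, unfolded mult] ..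
    also have "\<dots> = PIdl\<^bsub>?R\<^esub> (cbrt2 * cbrt2 * cbrt2)"
      unfolding closure.ideal_prod_principal[OF cL cL] closure.ideal_prod_principal[OF c2 cL] ..
    also have "cbrt2 * cbrt2 * cbrt2 = of_nat 2"
      using cbrt2_cube by (simp add: power3_eq_cube mult.assoc)
    finally have pow: "?P [^]\<^bsub>ideals_set ?R\<^esub> (3::nat) = PIdl\<^bsub>?R\<^esub> (of_nat 2)" .
    have "(\<Otimes>\<^bsub>ideals_set ?R\<^esub> P\<in>{?P}. P [^]\<^bsub>ideals_set ?R\<^esub> (3::nat)) = ?P [^]\<^bsub>ideals_set ?R\<^esub> (3::nat)"
      using PI by (subst I.finprod_insert) auto
    thus ?thesis unfolding prime_ideal_factorization_def pow using prime by simp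
  qed
  show ?thesis unfolding primes_above_def
    by (rule UnionI[of "{?P}"]) (rule CollectI, rule exI, rule fact, rule singletonI)
qed

text \<open>The element \<open>\<omega>\<close> is not fixed by squaring in the residue field at \<open>\<alpha>\<close>, as \<open>\<omega>\<^sup>2 - \<omega> = -(1 + 2 \<omega>)\<close>.\<close>

lemma lcm_splitting_type_closure_2: "\<not> lcm_mset (splitting_type cubic_closure 2) dvd 1"
proof
  assume "lcm_mset (splitting_type cubic_closure 2) dvd 1"
  hence all: "\<forall>P\<in>primes_above cubic_closure 2. \<forall>x\<in>carrier (ring_of_integers cubic_closure). x ^ (2 ^ 1) - x \<in> P"
    using closure.lcm_splitting_type_dvd_iff[OF closure_finite_residues[OF two_is_prime_nat] two_is_prime_nat, of 1]
    by simp
  have "omega ^ (2 ^ 1) - omega \<in> PIdl\<^bsub>ring_of_integers cubic_closure\<^esub> cbrt2"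
    using all cbrt2_prime_above_2 omega_mem algebraic_int_omega by (simp only: closure.R_simps) blast
  then obtain r where r: "algebraic_int r" "omega ^ 2 - omega = r * cbrt2"
    unfolding closure.principal_ideal_eq by auto
  moreover have "1 + 2 * omega = - (omega ^ 2 - omega)" by (simp add: omega_square)
  ultimately have "1 + 2 * omega = - r * cbrt2" by simp
  hence "(1 + 2 * omega) / cbrt2 = - r" by simp
  thus False using one_plus_two_omega_not_divisible_by_cbrt2 r by simp
qed

theorem theorem5p1:
  shows "\<exists>K1 K2. number_field K1 \<and> number_field K2 \<and>
    ultra_coarsely_arithmetically_equivalent K1 K2 \<and> exceptional_set K1 K2 \<noteq> {}"
proof (intro exI conjI)
  show "number_field pure_cubic_field" by (rule number_field_pure_cubic)
  show "number_field cubic_closure" by (rule number_field_cubic_closure)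
  have "exceptional_set pure_cubic_field cubic_closure \<subseteq> {2, 3}"
    using lcm_splitting_type_eq by (auto simp: exceptional_set_def)
  thus "ultra_coarsely_arithmetically_equivalent pure_cubic_field cubic_closure"
    unfolding ultra_coarsely_arithmetically_equivalent_def by (rule finite_subset) simp
  have "2 \<in> exceptional_set pure_cubic_field cubic_closure"
    using lcm_splitting_type_pure_cubic_2 lcm_splitting_type_closure_2
    unfolding exceptional_set_def by (metis (mono_tags, lifting) mem_Collect_eq two_is_prime_nat)
  thus "exceptional_set pure_cubic_field cubic_closure \<noteq> {}" by blast
qed

end
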